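(* Let $n$ be a positive integer and let $Z$ be an isotropic measure on the unit sphere $S^{n-1}\subset\mathbb{R}^n$ whose centroid is at the origin. Then $$|Z_\infty^*| \le \frac{n^{n/2}(n+1)^{(n+1)/2}}{n!},$$ with equality if and only if $Z_\infty$ is a regular simplex inscribed in $S^{n-1}$.
   Context: Throughout, $x\cdot y$ is the standard inner product on $\mathbb{R}^n$, $|x|$ is the Euclidean norm of a vector $x$, $S^{n-1}$ is the unit sphere of $\mathbb{R}^n$, and for a convex body $K\subset\mathbb{R}^n$, $|K|$ denotes its $n$-dimensional volume (Lebesgue measure). A finite nonnegative Borel measure $Z$ on $S^{n-1}$ is called isotropic if $|x|^2=\int_{S^{n-1}}|x\cdot u|^2\,dZ(u)$ for all $x\in\mathbb{R}^n$. The centroid of $Z$ is $\frac{1}{Z(S^{n-1})}\int_{S^{n-1}}u\,dZ(u)$. Define $Z_\infty=\operatorname{conv}(\operatorname{supp}Z)$, the convex hull of the support of $Z$, and its polar body $Z_\infty^*=\{x\in\mathbb{R}^n : x\cdot v\le 1 \text{ for all } v\in\operatorname{supp}Z\}$. A simplex is inscribed in $S^{n-1}$ if all its vertices lie on $S^{n-1}$. *)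

theory Defs
  imports "HOL-Analysis.Analysis"
begin

definition sphere_measure :: "'a::euclidean_space measure \<Rightarrow> bool" where
  "sphere_measure Z \<longleftrightarrow>
     sets Z = sets (restrict_space borel (sphere 0 1)) \<and> finite_measure Z"

definition isotropic :: "'a::euclidean_space measure \<Rightarrow> bool" where
  "isotropic Z \<longleftrightarrow>
     sphere_measure Z \<and> (\<forall>x. (norm x)\<^sup>2 = (\<integral>u. \<bar>x \<bullet> u\<bar>\<^sup>2 \<partial>Z))"

definition centroid :: "'a::euclidean_space measure \<Rightarrow> 'a" where
  "centroid Z = (1 / measure Z (space Z)) *\<^sub>R (\<integral>u. u \<partial>Z)"

definition supp :: "'a::topological_space measure \<Rightarrow> 'a set" where
  "supp Z = {u \<in> space Z. \<forall>U. open U \<and> u \<in> U \<longrightarrow> emeasure Z (U \<inter> space Z) > 0}"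

definition Z_inf :: "'a::euclidean_space measure \<Rightarrow> 'a set" where
  "Z_inf Z = convex hull (supp Z)"

definition Z_inf_polar :: "'a::euclidean_space measure \<Rightarrow> 'a set" where
  "Z_inf_polar Z = {x. \<forall>v\<in>supp Z. x \<bullet> v \<le> 1}"

definition vertices :: "'a::euclidean_space set \<Rightarrow> 'a set" where
  "vertices S = {v. v extreme_point_of S}"

(* Full-dimensional simplices only: the dimension is that of the ambient space. *)
definition regular_simplex :: "'a::euclidean_space set \<Rightarrow> bool" where
  "regular_simplex S \<longleftrightarrow>
     int DIM('a) simplex S \<and>
     (\<exists>d. \<forall>v\<in>vertices S. \<forall>w\<in>vertices S. v \<noteq> w \<longrightarrow> dist v w = d)"

definition inscribed_in_sphere :: "'a::euclidean_space set \<Rightarrow> bool" where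
  "inscribed_in_sphere S \<longleftrightarrow> vertices S \<subseteq> sphere 0 1"

end

theory Submission
  imports Defs "HOL-Probability.Probability"
begin

text \<open>
  Following Ball, Barthe, and Lutwak, Yang and Zhang, the volume of the polar body is computed as
  an integral over a cone in one dimension more, and this integral is bounded by transporting it
  to a Gaussian integral.

  Reduction to finite support. The conditions on \<open>Z\<close> say that the mean of the pairs \<open>(u u\<^sup>T, u)\<close>
  has a prescribed value. This value lies in the convex hull of the pairs with \<open>u\<close> in the support
  (\<open>barycentre_in_convex_hull\<close>), so there are finitely many support points \<open>U\<close> with weights \<open>c u >
  0\<close> that satisfy the same conditions (\<open>ex_centered_unit_frame\<close>). The polar of \<open>U\<close> contains that
  of \<open>Z\<close>, so it suffices to bound the former.

  Lift. Let \<open>w u\<close> be the vector of the space of dimension \<open>n + 1\<close> with first coordinate \<open>1 / sqrt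
  (n + 1)\<close> and remaining part \<open>- sqrt (n / (n + 1)) u\<close>. With the weights \<open>(n + 1) / n * c u\<close> these
  unit vectors again resolve the identity (\<open>lift_frame\<close>). The cone of all \<open>y\<close> with \<open>y \<bullet> w u > 0\<close>
  has multiples of the polar of \<open>U\<close> as its slices, and the integral of \<open>exp (- \<Sum> c u (y \<bullet> w u))\<close>
  over it (with the new weights) is the volume of the polar divided by the bound to be proved
  (\<open>nn_integral_cone_weight\<close>). So this integral has to be at most 1.

  Transport. Let \<open>\<phi>\<close> be the increasing map that carries the exponential law to the standard
  Gaussian law, and \<open>T y = \<Sum> c u \<phi> (y \<bullet> w u) w u\<close>, again with the new weights. Three facts give
  the bound: \<open>T\<close> is injective on the cone; its Jacobian determinant is at least \<open>\<Prod> \<phi>' (y \<bullet> w u)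
  powr c u\<close> by an inequality of Ball (\<open>frame_det_ge\<close>); and \<open>|T y|\<^sup>2 \<le> \<Sum> c u \<phi> (y \<bullet> w u)\<^sup>2\<close>
  (\<open>norm_synth\<close>). Hence the integrand is at most the Gaussian density at \<open>T y\<close> times the Jacobian,
  whose integral is at most 1 (\<open>nn_integral_cone_weight_le\<close>).

  Equality. If the integral is 1, the norm inequality is an equality everywhere, which means \<open>\<phi> (y
  \<bullet> w u) = T y \<bullet> w u\<close>. Approaching the facet of the cone that belongs to a single \<open>u\<close>, the
  left-hand side tends to minus infinity for this \<open>u\<close> and converges for the others, so \<open>w u\<close> is
  not in the span of the others (\<open>not_in_span_if_tight\<close>). Linearly independent unit vectors that
  resolve the identity are orthonormal, and orthogonality of the \<open>w u\<close> means \<open>u \<bullet> v = - 1 / n\<close>: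
  the \<open>n + 1\<close> points of \<open>U\<close> are the vertices of a regular simplex. The support of \<open>Z\<close> has no
  further points, since each would cut off volume (\<open>polar_loses_volume\<close>). Conversely, if the
  convex hull of the support is an inscribed simplex, then its vertices are the only support
  points. As the vectors \<open>w u\<close> span, \<open>U\<close> consists of all \<open>n + 1\<close> vertices; the lifted frame is
  orthonormal and every step is an equality (\<open>tight_if_irredundant\<close>).
\<close>

section \<open>Eigenbases of symmetric operators\<close>

text \<open>
  A unit vector of \<open>S\<close> maximising the quadratic form of \<open>f\<close> is an eigenvector: the residual
  \<open>z = f v - l v\<close> is a direction of first-order increase of the Rayleigh quotient unless it vanishes.
\<close>

lemma selfadjoint_eigenvector:
  fixes f :: "'a::euclidean_space \<Rightarrow> 'a"
  assumes f: "linear f" and self: "\<And>x y. f x \<bullet> y = x \<bullet> f y"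
    and S: "subspace S" "f ` S \<subseteq> S" "S \<noteq> {0}"
  obtains v l where "v \<in> S" "norm v = 1" "f v = l *\<^sub>R v"
proof -
  interpret linear f by (rule f)
  let ?K = "S \<inter> sphere 0 1"
  from S obtain x where x: "x \<in> S" "x \<noteq> 0" using subspace_0 by blast
  then have "x /\<^sub>R norm x \<in> ?K" using S by (auto simp: subspace_scale)
  then have "?K \<noteq> {}" by blast
  moreover have "compact ?K" using closed_subspace[OF S(1)] by (simp add: closed_Int_compact)
  moreover have "continuous_on ?K (\<lambda>x. x \<bullet> f x)"
    by (intro continuous_intros linear_continuous_on) (simp add: f linear_conv_bounded_linear[symmetric])
  ultimately obtain v where v: "v \<in> ?K" and max: "\<And>y. y \<in> ?K \<Longrightarrow> y \<bullet> f y \<le> v \<bullet> f v"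
    using continuous_attains_sup by meson
  define l where "l = v \<bullet> f v"
  have vv: "v \<bullet> v = 1" using v by (simp add: norm_eq_1)
  have le: "y \<bullet> f y \<le> l * (y \<bullet> y)" if "y \<in> S" for y
  proof (cases "y = 0")
    case False
    have "y /\<^sub>R norm y \<in> ?K" using that False S by (auto simp: subspace_scale)
    from max[OF this] have "(y \<bullet> f y) / (norm y)\<^sup>2 \<le> l"
      by (simp add: l_def scale power2_eq_square divide_inverse mult_ac)
    then show ?thesis using False by (simp add: divide_le_eq power2_norm_eq_inner)
  qed (simp add: zero)
  define z where "z = f v - l *\<^sub>R v"
  have zS: "z \<in> S" unfolding z_def using v S by (auto intro!: subspace_diff subspace_scale)
  define M where "M = l * (z \<bullet> z) - z \<bullet> f z"
  \<comment> \<open>Maximality at \<open>v + s z\<close>, divided by \<open>s\<close>; letting \<open>s\<close> tend to 0 forces \<open>z = 0\<close>.\<close>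
  have *: "2 * (z \<bullet> z) \<le> s * M" if "s > 0" for s
  proof -
    have "v + s *\<^sub>R z \<in> S" using v zS S by (auto intro!: subspace_add subspace_scale)
    from le[OF this] have "l + s * (z \<bullet> f v) + s * (v \<bullet> f z) + s * s * (z \<bullet> f z)
      \<le> l * (1 + 2 * s * (z \<bullet> v) + s * s * (z \<bullet> z))"
      by (simp add: add scale inner_add vv l_def[symmetric] algebra_simps inner_commute)
    moreover have "v \<bullet> f z = z \<bullet> f v" by (metis self inner_commute)
    ultimately have "2 * s * (z \<bullet> f v - l * (z \<bullet> v)) \<le> s * s * M"
      by (simp add: M_def algebra_simps)
    moreover have "z \<bullet> f v - l * (z \<bullet> v) = z \<bullet> z"
      by (simp add: z_def inner_diff_right)
    ultimately have "s * (2 * (z \<bullet> z)) \<le> s * (s * M)" by (simp add: mult_ac)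
    then show ?thesis using that by simp
  qed
  have "z \<bullet> z \<le> 0"
  proof (rule ccontr)
    assume "\<not> z \<bullet> z \<le> 0"
    then have p: "z \<bullet> z > 0" by linarith
    have "M > 0" using *[of 1] p by linarith
    from *[of "(z \<bullet> z) / M"] p this show False by simp
  qed
  then have "z = 0" by (metis inner_eq_zero_iff inner_ge_zero order_antisym)
  then show ?thesis using that[of v l] v by (simp add: z_def)
qed

text \<open>
  Split off one eigenvector; its orthogonal complement in \<open>S\<close> is again invariant because \<open>f\<close> is
  self-adjoint.
\<close>

lemma selfadjoint_eigenbasis_subspace:
  fixes f :: "'a::euclidean_space \<Rightarrow> 'a"
  assumes f: "linear f" and self: "\<And>x y. f x \<bullet> y = x \<bullet> f y"
    and "subspace S" "f ` S \<subseteq> S"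
  shows "\<exists>B l. finite B \<and> pairwise orthogonal B \<and> (\<forall>b\<in>B. norm b = 1 \<and> f b = l b *\<^sub>R b) \<and> span B = S"
  using assms(3,4)
proof (induction "dim S" arbitrary: S rule: less_induct)
  case less
  interpret linear f by (rule f)
  show ?case
  proof (cases "S = {0}")
    case True
    then show ?thesis by (intro exI[of _ "{}"]) auto
  next
    case False
    obtain v l where v: "v \<in> S" "norm v = 1" "f v = l *\<^sub>R v"
      using selfadjoint_eigenvector[OF f self less.prems False] .
    define S' where "S' = {x\<in>S. x \<bullet> v = 0}"
    have vv: "v \<bullet> v = 1" using v by (simp add: norm_eq_1)
    have sub: "subspace S'" using less.prems(1) unfolding S'_def subspace_def by (auto simp: inner_add_left)
    have inv: "f ` S' \<subseteq> S'" using less.prems(2) by (auto simp: S'_def self v)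
    have "v \<notin> S'" by (simp add: S'_def vv)
    have "dim S' \<le> dim S" by (rule dim_subset) (auto simp: S'_def)
    moreover have "dim S' \<noteq> dim S"
      using subspace_dim_equal[OF sub less.prems(1)] \<open>v \<notin> S'\<close> v(1) unfolding S'_def
      by (metis (no_types, lifting) \<open>v \<notin> S'\<close> S'_def mem_Collect_eq order_refl subsetI)
    ultimately have "dim S' < dim S" by simp
    from less.hyps[OF this sub inv] obtain B m where B: "finite B" "pairwise orthogonal B"
      "\<And>b. b \<in> B \<Longrightarrow> norm b = 1 \<and> f b = m b *\<^sub>R b" "span B = S'" by blast
    have BS: "B \<subseteq> S'" using B(4) span_superset by blast
    then have ob: "b \<bullet> v = 0" if "b \<in> B" for b using that by (auto simp: S'_def)
    have "v \<notin> B" using BS \<open>v \<notin> S'\<close> by blast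
    have "span (insert v B) = S"
    proof
      show "span (insert v B) \<subseteq> S"
        using BS v less.prems by (intro span_minimal) (auto simp: S'_def)
      show "S \<subseteq> span (insert v B)"
      proof
        fix x assume x: "x \<in> S"
        have "x - (x \<bullet> v) *\<^sub>R v \<in> S'"
          using x v less.prems by (auto simp: S'_def inner_diff_left vv intro!: subspace_diff subspace_scale)
        then show "x \<in> span (insert v B)" using B(4) by (auto simp: span_insert)
      qed
    qed
    moreover have "pairwise orthogonal (insert v B)"
      using B(2) ob by (auto simp: pairwise_insert orthogonal_def inner_commute)
    moreover have "\<forall>b\<in>insert v B. norm b = 1 \<and> f b = (m(v := l)) b *\<^sub>R b"
      using B(3) v \<open>v \<notin> B\<close> by auto
    ultimately show ?thesis using B(1) by (intro exI[of _ "insert v B"]) blast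
  qed
qed

lemma selfadjoint_eigenbasis:
  fixes f :: "real^'m \<Rightarrow> real^'m"
  assumes f: "linear f" and self: "\<And>x y. f x \<bullet> y = x \<bullet> f y"
  obtains e :: "'m \<Rightarrow> real^'m" and l
  where "\<And>i j. e i \<bullet> e j = (if i = j then 1 else 0)" "\<And>i. f (e i) = l i *\<^sub>R e i"
proof -
  obtain B m where B: "finite B" "pairwise orthogonal B"
      "\<And>b. b \<in> B \<Longrightarrow> norm b = 1 \<and> f b = m b *\<^sub>R b" "span B = UNIV"
    using selfadjoint_eigenbasis_subspace[OF f self subspace_UNIV] by blast
  have "independent B" using B(2,3) by (intro pairwise_orthogonal_independent) fastforce+
  then have "card B = CARD('m)" using dim_span_eq_card_independent[of B] B(4) by simp
  then obtain e where e: "bij_betw e (UNIV :: 'm set) B"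
    using B(1) finite_same_card_bij by (metis finite_class.finite_UNIV)
  have "e i \<in> B" for i using e by (auto simp: bij_betw_def)
  moreover have "e i \<noteq> e j" if "i \<noteq> j" for i j using e that by (auto simp: bij_betw_def inj_on_def)
  ultimately have "e i \<bullet> e j = (if i = j then 1 else 0)" for i j
    using B(2,3) by (auto simp: pairwise_def orthogonal_def norm_eq_1)
  then show ?thesis using that[of e "m \<circ> e"] B(3) \<open>\<And>i. e i \<in> B\<close> by auto
qed

text \<open>
  The determinant is read off without constructing an inverse: with \<open>P\<close> the matrix whose rows are the
  \<open>e i\<close>, the eigenvector equations say \<open>F P\<^sup>T = P\<^sup>T D\<close>, and \<open>det P\<close> is nonzero.
\<close>

lemma det_orthonormal_eigenbasis:
  fixes e :: "'m::finite \<Rightarrow> real^'m"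
  assumes f: "linear f" and on: "\<And>i j. e i \<bullet> e j = (if i = j then 1 else 0)"
    and eig: "\<And>i. f (e i) = l i *\<^sub>R e i"
  shows "det (matrix f) = (\<Prod>i\<in>UNIV. l i)"
proof -
  define P :: "real^'m^'m" where "P = (\<chi> i. e i)"
  define D :: "real^'m^'m" where "D = (\<chi> i j. if i = j then l i else 0)"
  have PP: "P ** transpose P = mat 1"
    by (simp add: vec_eq_iff matrix_matrix_mult_def transpose_def P_def mat_def on flip: inner_vec_def[where 'a=real, simplified])
  have "column k (matrix f ** transpose P) = column k (transpose P ** D)" for k
  proof -
    have "column k (matrix f ** transpose P) = matrix f *v e k"
      by (simp add: vec_eq_iff column_def matrix_matrix_mult_def matrix_vector_mult_def transpose_def P_def)
    also have "\<dots> = l k *\<^sub>R e k" using f eig by (simp add: matrix_works)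
    also have "\<dots> = column k (transpose P ** D)"
      by (simp add: vec_eq_iff column_def matrix_matrix_mult_def transpose_def P_def D_def if_distrib cong: if_cong)
    finally show ?thesis .
  qed
  then have "matrix f ** transpose P = transpose P ** D"
    by (simp add: vec_eq_iff column_def)
  then have "det (matrix f) * det (transpose P) = det (transpose P) * det D"
    by (metis det_mul)
  moreover have "det (transpose P) \<noteq> 0"
    using arg_cong[OF PP, of det] by (auto simp: det_mul)
  moreover have "det D = (\<Prod>i\<in>UNIV. l i)"
    by (subst det_diagonal) (auto simp: D_def)
  ultimately show ?thesis by simp
qed

section \<open>Monotone transport between the exponential and the Gaussian law\<close>

text \<open>
  The increasing map carrying the standard Gaussian law to the exponential law of density \<open>exp (- t)\<close> on
  the positive half-line: it matches the tails, \<open>exp (- exp_of_gaussian s) = P (X > s) = P (X \<le> - s)\<close> for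
  a Gaussian \<open>X\<close>.
\<close>

definition exp_of_gaussian :: "real \<Rightarrow> real" where
  "exp_of_gaussian s = - ln (cdf (density lborel std_normal_density) (- s))"

lemma std_normal_cdf_deriv:
  "(cdf (density lborel std_normal_density) has_real_derivative std_normal_density s) (at s)"
proof -
  let ?M = "density lborel std_normal_density"
  interpret real_distribution ?M
    by (simp add: real_distribution_def real_distribution_axioms_def prob_space_normal_density)
  define a where "a = s - 1"
  have ab: "integral {a..x} std_normal_density = cdf ?M x - cdf ?M a" if "x \<in> {a<..}" for x
  proof -
    have "cdf ?M x - cdf ?M a = measure ?M {a<..x}" using that by (intro cdf_diff_eq) auto
    also have "\<dots> = integral\<^sup>L lborel (\<lambda>y. std_normal_density y * indicator {a<..x} y)"
    proof -
      have "emeasure ?M {a<..x} = (\<integral>\<^sup>+y. ennreal (std_normal_density y * indicator {a<..x} y) \<partial>lborel)"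
        by (subst emeasure_density) (auto intro!: nn_integral_cong split: split_indicator)
      then show ?thesis unfolding measure_def
        by (subst integral_eq_nn_integral) (auto)
    qed
    also have "\<dots> = set_lebesgue_integral lborel {a<..x} std_normal_density"
      by (simp add: set_lebesgue_integral_def mult_ac)
    also have "\<dots> = integral {a<..x} std_normal_density"
    proof (rule set_borel_integral_eq_integral(2))
      show "set_integrable lborel {a<..x} std_normal_density"
        unfolding set_integrable_def
        by (intro integrable_mult_indicator) auto
    qed
    also have "\<dots> = integral {a..x} std_normal_density"
      by (rule integral_subset_negligible) (auto intro: negligible_subset[of "{a}"])
    finally show ?thesis by simp
  qed
  have "((\<lambda>x. integral {a..x} std_normal_density) has_real_derivative std_normal_density s) (at s within {a..s+1})"
    by (rule integral_has_real_derivative)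
      (auto simp: a_def normal_density_def intro!: continuous_intros)
  then have "((\<lambda>x. integral {a..x} std_normal_density) has_real_derivative std_normal_density s) (at s)"
    by (subst (asm) at_within_Icc_at) (auto simp: a_def)
  then have "((\<lambda>x. cdf ?M a + integral {a..x} std_normal_density) has_real_derivative std_normal_density s) (at s)"
    by (auto intro!: derivative_eq_intros)
  then show ?thesis
    by (rule has_field_derivative_transform_within_open[of _ _ _ "{a<..}"]) (auto simp: ab a_def[symmetric], simp add: a_def)
qed

lemma std_normal_cdf_pos_less_1:
  "0 < cdf (density lborel std_normal_density) s" "cdf (density lborel std_normal_density) s < 1"
proof -
  let ?M = "density lborel std_normal_density"
  interpret real_distribution ?M
    by (simp add: real_distribution_def real_distribution_axioms_def prob_space_normal_density)
  have less: "cdf ?M x < cdf ?M y" if "x < y" for x y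
    using that by (rule DERIV_pos_imp_increasing) (auto intro!: exI std_normal_cdf_deriv normal_density_pos)
  show "0 < cdf ?M s" using less[of "s - 1" s] cdf_nonneg[of "s - 1"] by simp
  show "cdf ?M s < 1" using less[of s "s + 1"] cdf_bounded_prob[of "s + 1"] by simp
qed

lemma exp_of_gaussian_pos: "exp_of_gaussian s > 0"
  using std_normal_cdf_pos_less_1[of "-s"] by (simp add: exp_of_gaussian_def)

lemma exp_minus_exp_of_gaussian: "exp (- exp_of_gaussian s) = cdf (density lborel std_normal_density) (- s)"
  using std_normal_cdf_pos_less_1[of "-s"] by (simp add: exp_of_gaussian_def)

lemma exp_of_gaussian_deriv:
  "(exp_of_gaussian has_real_derivative std_normal_density s / exp (- exp_of_gaussian s)) (at s)"
proof -
  have "((\<lambda>s. cdf (density lborel std_normal_density) (- s)) has_real_derivative std_normal_density (-s) * (-1)) (at s)"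
    by (rule DERIV_chain2[OF std_normal_cdf_deriv]) (auto intro!: derivative_eq_intros)
  moreover have "std_normal_density (-s) = std_normal_density s" by (simp add: normal_density_def)
  ultimately show ?thesis
    unfolding exp_minus_exp_of_gaussian unfolding exp_of_gaussian_def[abs_def]
    using std_normal_cdf_pos_less_1[of "-s"]
    by (auto intro!: derivative_eq_intros simp del: std_normal_density_def)
qed

lemma strict_mono_exp_of_gaussian: "strict_mono exp_of_gaussian"
  by (rule strict_monoI, erule DERIV_pos_imp_increasing)
    (auto intro!: exI exp_of_gaussian_deriv divide_pos_pos normal_density_pos)

lemma exp_of_gaussian_surj:
  assumes "t > 0" shows "\<exists>s. exp_of_gaussian s = t"
proof -
  let ?M = "density lborel std_normal_density"
  interpret real_distribution ?M
    by (simp add: real_distribution_def real_distribution_axioms_def prob_space_normal_density)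
  have cont: "isCont (cdf ?M) x" for x using std_normal_cdf_deriv by (rule DERIV_isCont)
  have 1: "exp (-t) < 1" "0 < exp (-t)" using assms by auto
  have "eventually (\<lambda>x. cdf ?M x < exp (-t)) at_bot" using cdf_lim_at_bot 1(2) by (rule order_tendstoD)
  then obtain a where a: "cdf ?M a < exp (-t)" by (auto simp: eventually_at_bot_linorder)
  have "eventually (\<lambda>x. cdf ?M x > exp (-t)) at_top" using cdf_lim_at_top_prob 1(1) by (rule order_tendstoD)
  then obtain b where b: "cdf ?M b > exp (-t)" by (auto simp: eventually_at_top_linorder)
  have "a \<le> b" using a b cdf_nondecreasing[of b a] by linarith
  then obtain x where "cdf ?M x = exp (-t)" using IVT[of "cdf ?M" a "exp (-t)" b] a b cont by auto
  then have "exp_of_gaussian (-x) = t" by (simp add: exp_of_gaussian_def)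
  then show ?thesis ..
qed

text \<open>
  Only values at positive arguments are meaningful. What the equality case uses is that this inverse tends
  to minus infinity at 0.
\<close>

definition gaussian_of_exp :: "real \<Rightarrow> real" where
  "gaussian_of_exp = inv exp_of_gaussian"

lemma gaussian_of_exp_inverse: "gaussian_of_exp (exp_of_gaussian s) = s"
  unfolding gaussian_of_exp_def
  by (intro inv_f_f strict_mono_imp_inj_on strict_mono_exp_of_gaussian)

lemma exp_of_gaussian_inverse: "t > 0 \<Longrightarrow> exp_of_gaussian (gaussian_of_exp t) = t"
  unfolding gaussian_of_exp_def using exp_of_gaussian_surj[of t] by (metis f_inv_into_f rangeI)

lemma gaussian_of_exp_less_iff:
  "0 < s \<Longrightarrow> 0 < t \<Longrightarrow> gaussian_of_exp s < gaussian_of_exp t \<longleftrightarrow> s < t"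
  by (metis exp_of_gaussian_inverse strict_mono_exp_of_gaussian strict_mono_less)

text \<open>
  The transport equation: \<open>exp (- t)\<close> is the Gaussian density at \<open>gaussian_of_exp t\<close> times the derivative.
\<close>

lemma gaussian_of_exp_deriv:
  assumes "t > 0"
  shows "(gaussian_of_exp has_real_derivative exp (- t) / std_normal_density (gaussian_of_exp t)) (at t)"
proof -
  let ?s = "gaussian_of_exp t"
  have cont: "isCont exp_of_gaussian x" for x using exp_of_gaussian_deriv by (rule DERIV_isCont)
  have "isCont gaussian_of_exp (exp_of_gaussian ?s)"
    by (rule isCont_inverse_function[of 1]) (auto simp: gaussian_of_exp_inverse cont)
  then have "isCont gaussian_of_exp t" using assms by (simp add: exp_of_gaussian_inverse)
  have "(gaussian_of_exp has_real_derivative inverse (std_normal_density ?s / exp (- t))) (at t)"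
  proof (rule DERIV_inverse_function[of exp_of_gaussian _ _ _ 0 "t + 1"])
    show "(exp_of_gaussian has_real_derivative std_normal_density ?s / exp (- t)) (at ?s)"
      using exp_of_gaussian_deriv[of ?s] assms by (simp add: exp_of_gaussian_inverse)
    show "std_normal_density ?s / exp (- t) \<noteq> 0" by (simp add: normal_density_def)
  qed (use assms \<open>isCont gaussian_of_exp t\<close> in \<open>auto simp: exp_of_gaussian_inverse\<close>)
  then show ?thesis by simp
qed

section \<open>Weighted unit vectors that resolve the identity\<close>

text \<open>
  Unit vectors \<open>w i\<close> with weights \<open>c i\<close> such that \<open>\<Sum> c i w i w i\<^sup>T\<close> is the identity; this is an
  isotropic measure with finite support. The index set allows the vectors to be renamed by a lift.
\<close>

locale unit_frame =
  fixes I :: "'i set" and w :: "'i \<Rightarrow> 'a::euclidean_space" and c :: "'i \<Rightarrow> real"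
  assumes finite_I: "finite I"
    and c_pos: "i \<in> I \<Longrightarrow> c i > 0"
    and norm_w: "i \<in> I \<Longrightarrow> norm (w i) = 1"
    and frame: "(\<Sum>i\<in>I. (c i * (y \<bullet> w i)) *\<^sub>R w i) = y"
begin

lemma inner_frame: "(\<Sum>i\<in>I. c i * (y \<bullet> w i) * (z \<bullet> w i)) = y \<bullet> z"
  using arg_cong[OF frame[of y], of "\<lambda>v. z \<bullet> v"] by (simp add: inner_sum_right inner_commute)

text \<open>
  Trace of the identity \<open>\<Sum> c i w i w i\<^sup>T = 1\<close>.
\<close>

lemma sum_c: "(\<Sum>i\<in>I. c i) = DIM('a)"
proof -
  have "real DIM('a) = (\<Sum>b\<in>Basis. (b::'a) \<bullet> b)" by simp
  also have "\<dots> = (\<Sum>b\<in>Basis. \<Sum>i\<in>I. c i * (b \<bullet> w i) * (b \<bullet> w i))" by (simp add: inner_frame)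
  also have "\<dots> = (\<Sum>i\<in>I. \<Sum>b\<in>Basis. c i * (b \<bullet> w i) * (b \<bullet> w i))" by (rule sum.swap)
  also have "\<dots> = (\<Sum>i\<in>I. c i * (w i \<bullet> w i))"
    by (intro sum.cong refl) (subst euclidean_inner, simp add: sum_distrib_left inner_commute mult_ac)
  also have "\<dots> = (\<Sum>i\<in>I. c i)" using norm_w by (intro sum.cong) (auto simp: norm_eq_1)
  finally show ?thesis by simp
qed

text \<open>
  The synthesis operator of the frame. It does not increase the weighted Euclidean norm, and \<open>defect\<close>
  measures by how much it decreases its square; it vanishes exactly if \<open>s\<close> consists of the frame
  coefficients of a vector.
\<close>

definition synth :: "('i \<Rightarrow> real) \<Rightarrow> 'a" where
  "synth s = (\<Sum>i\<in>I. (c i * s i) *\<^sub>R w i)"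

definition defect :: "('i \<Rightarrow> real) \<Rightarrow> real" where
  "defect s = (\<Sum>i\<in>I. c i * (s i - synth s \<bullet> w i)\<^sup>2)"

lemma defect_nonneg: "defect s \<ge> 0"
  unfolding defect_def using c_pos by (intro sum_nonneg mult_nonneg_nonneg) (auto simp: less_imp_le)

lemma defect_eq_0_iff: "defect s = 0 \<longleftrightarrow> (\<forall>i\<in>I. s i = synth s \<bullet> w i)"
proof -
  have "defect s = 0 \<longleftrightarrow> (\<forall>i\<in>I. c i * (s i - synth s \<bullet> w i)\<^sup>2 = 0)"
    unfolding defect_def using c_pos finite_I by (intro sum_nonneg_eq_0_iff) (auto simp: less_imp_le)
  then show ?thesis using c_pos by fastforce
qed

lemma norm_synth: "(norm (synth s))\<^sup>2 + defect s = (\<Sum>i\<in>I. c i * (s i)\<^sup>2)"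
proof -
  let ?T = "synth s"
  have 1: "(\<Sum>i\<in>I. c i * s i * (?T \<bullet> w i)) = ?T \<bullet> ?T"
    by (subst (3) synth_def) (simp add: inner_sum_right mult_ac)
  have "defect s = (\<Sum>i\<in>I. c i * (s i)\<^sup>2) - 2 * (\<Sum>i\<in>I. c i * s i * (?T \<bullet> w i)) + (\<Sum>i\<in>I. c i * (?T \<bullet> w i) * (?T \<bullet> w i))"
    unfolding defect_def sum_distrib_left sum_subtractf[symmetric] sum.distrib[symmetric]
    by (intro sum.cong refl) (simp add: power2_eq_square algebra_simps)
  then show ?thesis unfolding 1 inner_frame by (simp add: power2_norm_eq_inner)
qed

definition cone :: "'a set" where
  "cone = {y. \<forall>i\<in>I. y \<bullet> w i > 0}"

lemma open_cone: "open cone"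
proof -
  have "cone = (\<Inter>i\<in>I. {y. 0 < y \<bullet> w i})" by (auto simp: cone_def)
  then show ?thesis using finite_I by (auto intro!: open_INT open_Collect_less continuous_intros)
qed

text \<open>
  The Brenier-type map of the Brascamp-Lieb argument: each frame coefficient is moved from the exponential
  to the Gaussian law and the results are recombined.
\<close>

definition transport :: "'a \<Rightarrow> 'a" where
  "transport y = synth (\<lambda>i. gaussian_of_exp (y \<bullet> w i))"

definition stretch :: "'i \<Rightarrow> 'a \<Rightarrow> real" where
  "stretch i y = exp (- (y \<bullet> w i)) / std_normal_density (gaussian_of_exp (y \<bullet> w i))"

definition transport_deriv :: "'a \<Rightarrow> 'a \<Rightarrow> 'a" where
  "transport_deriv y h = synth (\<lambda>i. stretch i y * (h \<bullet> w i))"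

lemma stretch_pos: "stretch i y > 0"
  unfolding stretch_def by (intro divide_pos_pos) (auto intro: normal_density_pos simp del: std_normal_density_def)

lemma has_derivative_transport:
  assumes "y \<in> cone" shows "(transport has_derivative transport_deriv y) (at y)"
proof -
  have "((\<lambda>y. gaussian_of_exp (y \<bullet> w i)) has_derivative (\<lambda>h. stretch i y * (h \<bullet> w i))) (at y)" if "i \<in> I" for i
  proof -
    have "(gaussian_of_exp has_derivative (*) (stretch i y)) (at (y \<bullet> w i))"
      using gaussian_of_exp_deriv[of "y \<bullet> w i"] assms that
      unfolding stretch_def cone_def has_field_derivative_def by blast
    moreover have "((\<lambda>y. y \<bullet> w i) has_derivative (\<lambda>h. h \<bullet> w i)) (at y)"
      by (auto intro!: derivative_eq_intros)
    ultimately show ?thesis using has_derivative_compose by blast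
  qed
  then show ?thesis
    unfolding transport_def[abs_def] transport_deriv_def[abs_def] synth_def
    by (intro has_derivative_sum) (auto intro!: derivative_eq_intros simp: mult_ac)
qed

text \<open>
  Strict monotonicity: \<open>(transport y - transport z) \<bullet> (y - z)\<close> is a sum of nonnegative terms, which vanish
  only if \<open>y\<close> and \<open>z\<close> have the same frame coefficients.
\<close>

lemma inj_transport: "inj_on transport cone"
proof (rule inj_onI)
  fix y z assume yz: "y \<in> cone" "z \<in> cone" "transport y = transport z"
  let ?p = "\<lambda>i. (gaussian_of_exp (y \<bullet> w i) - gaussian_of_exp (z \<bullet> w i)) * (y \<bullet> w i - z \<bullet> w i)"
  have pp: "?p i \<ge> 0 \<and> (?p i = 0 \<longrightarrow> y \<bullet> w i = z \<bullet> w i)" if "i \<in> I" for i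
  proof -
    have "0 < y \<bullet> w i" "0 < z \<bullet> w i" using yz that by (auto simp: cone_def)
    then show ?thesis
      using gaussian_of_exp_less_iff[of "y \<bullet> w i" "z \<bullet> w i"] gaussian_of_exp_less_iff[of "z \<bullet> w i" "y \<bullet> w i"]
      by (cases "y \<bullet> w i" "z \<bullet> w i" rule: linorder_cases)
        (auto intro!: mult_nonneg_nonneg mult_nonpos_nonpos simp: less_imp_le)
  qed
  have "(\<Sum>i\<in>I. c i * ?p i) = (transport y - transport z) \<bullet> (y - z)"
    unfolding transport_def synth_def sum_subtractf[symmetric] inner_sum_left
    by (intro sum.cong refl) (simp add: inner_diff_left inner_diff_right algebra_simps inner_commute)
  then have "(\<Sum>i\<in>I. c i * ?p i) = 0" using yz(3) by simp
  then have "\<forall>i\<in>I. c i * ?p i = 0"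
    using pp c_pos finite_I by (subst (asm) sum_nonneg_eq_0_iff) (auto intro!: mult_nonneg_nonneg simp: less_imp_le)
  then have "y \<bullet> w i = z \<bullet> w i" if "i \<in> I" for i using pp[OF that] c_pos[OF that] that by fastforce
  then have "(\<Sum>i\<in>I. (c i * (y \<bullet> w i)) *\<^sub>R w i) = (\<Sum>i\<in>I. (c i * (z \<bullet> w i)) *\<^sub>R w i)" by simp
  then show "y = z" by (simp only: frame)
qed

lemma prod_std_normal:
  "(\<Prod>i\<in>I. std_normal_density (s i) powr c i)
     = exp (- (norm (synth s))\<^sup>2 / 2) / sqrt (2 * pi) ^ DIM('a) * exp (- defect s / 2)"
proof -
  have "std_normal_density (s i) powr c i = exp (- (c i * (s i)\<^sup>2) / 2 - c i * ln (sqrt (2 * pi)))" for i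
    by (simp add: std_normal_density_def powr_def ln_mult ln_div algebra_simps)
  then have "(\<Prod>i\<in>I. std_normal_density (s i) powr c i) = exp (\<Sum>i\<in>I. - (c i * (s i)\<^sup>2) / 2 - c i * ln (sqrt (2 * pi)))"
    using finite_I by (simp add: exp_sum)
  also have "(\<Sum>i\<in>I. - (c i * (s i)\<^sup>2) / 2 - c i * ln (sqrt (2 * pi)))
    = - (\<Sum>i\<in>I. c i * (s i)\<^sup>2) / 2 - DIM('a) * ln (sqrt (2 * pi))"
    by (simp add: sum_subtractf sum_negf sum_divide_distrib sum_distrib_right[symmetric] sum_c)
  also have "\<dots> = - (norm (synth s))\<^sup>2 / 2 + - defect s / 2 - DIM('a) * ln (sqrt (2 * pi))"
    unfolding norm_synth[symmetric] by (simp add: field_simps)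
  also have "exp \<dots> = exp (- (norm (synth s))\<^sup>2 / 2) / sqrt (2 * pi) ^ DIM('a) * exp (- defect s / 2)"
    unfolding exp_diff exp_add exp_of_nat_mult by simp
  finally show ?thesis .
qed

text \<open>
  The one-dimensional transport equations, raised to the powers \<open>c i\<close> and multiplied. The weights
  add up to the dimension, so the Gaussian factors combine into the Gaussian density at the image point,
  up to the factor coming from the defect.
\<close>

lemma density_transport:
  assumes "y \<in> cone"
  shows "exp (- (\<Sum>i\<in>I. c i * (y \<bullet> w i)))
    = exp (- (norm (transport y))\<^sup>2 / 2) / sqrt (2 * pi) ^ DIM('a)
      * exp (- defect (\<lambda>i. gaussian_of_exp (y \<bullet> w i)) / 2) * (\<Prod>i\<in>I. stretch i y powr c i)"
proof -
  let ?s = "\<lambda>i. gaussian_of_exp (y \<bullet> w i)"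
  have "exp (- (\<Sum>i\<in>I. c i * (y \<bullet> w i))) = (\<Prod>i\<in>I. exp (- (y \<bullet> w i)) powr c i)"
    using finite_I by (simp add: powr_def exp_sum sum_negf[symmetric])
  also have "\<dots> = (\<Prod>i\<in>I. std_normal_density (?s i) powr c i * stretch i y powr c i)"
  proof (intro prod.cong refl)
    fix i
    have p: "std_normal_density (?s i) > 0" by (rule normal_density_pos) simp
    then have "exp (- (y \<bullet> w i)) = std_normal_density (?s i) * stretch i y"
      unfolding stretch_def by simp
    then show "exp (- (y \<bullet> w i)) powr c i = std_normal_density (?s i) powr c i * stretch i y powr c i"
      using p stretch_pos[of i y] by (simp add: powr_mult del: std_normal_density_def)
  qed
  finally show ?thesis unfolding prod.distrib prod_std_normal transport_def .
qed

text \<open>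
  A vector outside the span of the others has a unique coefficient in the expansion
  \<open>w j = \<Sum> c i (w j \<bullet> w i) w i\<close>, so \<open>c j = 1\<close>. Then the identity for \<open>|w j|\<^sup>2\<close> leaves nothing for the
  other inner products.
\<close>

lemma orthonormal_if_irredundant:
  assumes irr: "\<And>i. i \<in> I \<Longrightarrow> w i \<notin> span (w ` (I - {i}))"
    and j: "j \<in> I"
  shows "c j = 1" and "i \<in> I \<Longrightarrow> i \<noteq> j \<Longrightarrow> w i \<bullet> w j = 0"
proof -
  have ww: "w j \<bullet> w j = 1" using norm_w[OF j] by (simp add: norm_eq_1)
  \<comment> \<open>Otherwise dividing by \<open>1 - c j\<close> would put \<open>w j\<close> into the span of the others.\<close>
  have "w j = c j *\<^sub>R w j + (\<Sum>i\<in>I-{j}. (c i * (w j \<bullet> w i)) *\<^sub>R w i)"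
    using frame[of "w j"] finite_I j by (simp add: sum.remove ww)
  then have "(1 - c j) *\<^sub>R w j = (\<Sum>i\<in>I-{j}. (c i * (w j \<bullet> w i)) *\<^sub>R w i)"
    by (simp add: algebra_simps)
  also have "\<dots> \<in> span (w ` (I - {j}))"
    by (intro span_sum span_scale span_base) auto
  finally have "(1 - c j) *\<^sub>R w j \<in> span (w ` (I - {j}))" .
  then have "(1 / (1 - c j)) *\<^sub>R ((1 - c j) *\<^sub>R w j) \<in> span (w ` (I - {j}))" by (rule span_scale)
  then show cj: "c j = 1" using irr[OF j] by (cases "c j = 1") auto
  have "1 = c j * 1 + (\<Sum>i\<in>I-{j}. c i * (w j \<bullet> w i) * (w j \<bullet> w i))"
    using inner_frame[of "w j" "w j"] finite_I j by (simp add: sum.remove ww)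
  then have "(\<Sum>i\<in>I-{j}. c i * (w j \<bullet> w i) * (w j \<bullet> w i)) = 0" by (simp add: cj)
  then have "\<forall>i\<in>I-{j}. c i * (w j \<bullet> w i) * (w j \<bullet> w i) = 0"
    using finite_I c_pos
    by (subst (asm) sum_nonneg_eq_0_iff) (auto simp: mult.assoc less_imp_le intro!: mult_nonneg_nonneg)
  then have "c i * (w j \<bullet> w i) * (w j \<bullet> w i) = 0" if "i \<in> I" "i \<noteq> j"
    using that by blast
  then show "w i \<bullet> w j = 0" if "i \<in> I" "i \<noteq> j"
    using that c_pos[OF that(1)] by (simp add: inner_commute)
qed

lemma card_irredundant:
  assumes "\<And>i. i \<in> I \<Longrightarrow> w i \<notin> span (w ` (I - {i}))"
  shows "card I = DIM('a)"
  using sum_c orthonormal_if_irredundant(1)[OF assms] by simp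

lemma span_frame: "span (w ` I) = UNIV"
proof -
  have "y \<in> span (w ` I)" for y
    by (subst frame[symmetric]) (intro span_sum span_scale span_base, auto)
  then show ?thesis by auto
qed

lemma card_ge_dim: "card I \<ge> DIM('a)"
proof -
  have "DIM('a) = dim (span (w ` I))" by (simp add: span_frame)
  also have "\<dots> \<le> card (w ` I)" unfolding dim_span using finite_I by (intro dim_le_card') auto
  also have "\<dots> \<le> card I" using finite_I by (rule card_image_le)
  finally show ?thesis .
qed

lemma irredundant_if_card:
  assumes "card I = DIM('a)" "i \<in> I"
  shows "w i \<notin> span (w ` (I - {i}))"
proof
  assume wi: "w i \<in> span (w ` (I - {i}))"
  have "w j \<in> span (w ` (I - {i}))" if "j \<in> I" for j
    using that wi by (cases "j = i") (auto intro: span_base)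
  then have "w ` I \<subseteq> span (w ` (I - {i}))" by blast
  from span_minimal[OF this subspace_span] have "span (w ` (I - {i})) = UNIV" by (simp add: span_frame top.extremum_unique)
  then have "DIM('a) = dim (w ` (I - {i}))" by (metis dim_UNIV dim_span)
  also have "\<dots> \<le> card (w ` (I - {i}))" using finite_I by (intro dim_le_card') auto
  also have "\<dots> \<le> card (I - {i})" using finite_I by (intro card_image_le) auto
  also have "\<dots> < card I" using finite_I assms(2) by (rule card_Diff1_less)
  finally show False using assms(1) by simp
qed

end

section \<open>Ball's determinant inequality\<close>

text \<open>
  Ball's inequality. In an orthonormal eigenbasis \<open>e k\<close> of \<open>\<Sum> c i t i w i w i\<^sup>T\<close> the eigenvalue \<open>l k\<close> is the
  mean of the \<open>t i\<close> with respect to the probabilities \<open>p k i = c i (e k \<bullet> w i)\<^sup>2\<close>. Concavity of the logarithm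
  bounds \<open>ln (l k)\<close> below, and summing over \<open>k\<close> turns \<open>p k i\<close> into \<open>c i |w i|\<^sup>2 = c i\<close>.
\<close>

lemma frame_det_ge:
  fixes w :: "'i \<Rightarrow> real^'m"
  assumes "unit_frame I w c" and t: "\<And>i. i \<in> I \<Longrightarrow> t i > 0"
  shows "(\<Prod>i\<in>I. t i powr c i) \<le> det (matrix (\<lambda>x. unit_frame.synth I w c (\<lambda>i. t i * (x \<bullet> w i))))"
proof -
  interpret unit_frame I w c by fact
  define f where "f = (\<lambda>x. synth (\<lambda>i. t i * (x \<bullet> w i)))"
  have lin: "linear f" unfolding f_def synth_def
    by (intro linearI) (auto simp: inner_add algebra_simps sum.distrib scaleR_sum_right)
  have ip: "x \<bullet> f y = (\<Sum>i\<in>I. c i * t i * (x \<bullet> w i) * (y \<bullet> w i))" for x y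
    unfolding f_def synth_def by (simp add: inner_sum_right mult_ac)
  have self: "f x \<bullet> y = x \<bullet> f y" for x y
    by (subst inner_commute) (simp only: ip mult_ac)
  obtain e :: "'m \<Rightarrow> real^'m" and l where on: "\<And>i j. e i \<bullet> e j = (if i = j then 1 else 0)"
    and eig: "\<And>i. f (e i) = l i *\<^sub>R e i"
    by (rule selfadjoint_eigenbasis[OF lin self]) (rule that)
  define p where "p k i = c i * (e k \<bullet> w i)\<^sup>2" for k i
  have p0: "p k i \<ge> 0" if "i \<in> I" for k i using c_pos[OF that] by (simp add: p_def)
  have p1: "(\<Sum>i\<in>I. p k i) = 1" for k
    using inner_frame[of "e k" "e k"] by (simp add: p_def on power2_eq_square mult.assoc)
  have l: "l k = (\<Sum>i\<in>I. p k i * t i)" for k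
    using ip[of "e k" "e k"] by (simp add: eig on p_def power2_eq_square mult_ac)
  have lpos: "l k > 0" for k
  proof -
    have "\<exists>i\<in>I. p k i \<noteq> 0" using p1[of k] by (metis sum.neutral zero_neq_one)
    then obtain i where "i \<in> I" "p k i \<noteq> 0" by blast
    then have i: "i \<in> I" "p k i > 0" using p0[of i k] by auto
    show ?thesis unfolding l
      by (rule sum_pos2[OF finite_I i(1)]) (use p0 t i in \<open>auto intro!: mult_pos_pos mult_nonneg_nonneg simp: less_imp_le\<close>)
  qed
  have jensen: "(\<Sum>i\<in>I. p k i * ln (t i)) \<le> ln (l k)" for k
  proof -
    have "(\<Sum>i\<in>I. p k i * ln (t i)) \<le> (\<Sum>i\<in>I. p k i * (ln (l k) + (t i / l k - 1)))"
    proof (intro sum_mono mult_left_mono p0)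
      fix i assume i: "i \<in> I"
      \<comment> \<open>The tangent of the logarithm at \<open>l k\<close>.\<close>
      have "ln (t i / l k) \<le> t i / l k - 1" using t[OF i] lpos by (intro ln_le_minus_one) simp
      then show "ln (t i) \<le> ln (l k) + (t i / l k - 1)" using t[OF i] lpos[of k] by (simp add: ln_div)
    qed
    also have "\<dots> = ln (l k) * (\<Sum>i\<in>I. p k i) + (\<Sum>i\<in>I. p k i * t i) / l k - (\<Sum>i\<in>I. p k i)"
      by (simp add: algebra_simps sum.distrib sum_subtractf sum_distrib_left sum_divide_distrib)
    also have "\<dots> = ln (l k)" using lpos[of k] by (simp add: p1 l[symmetric])
    finally show ?thesis .
  qed
  have pc: "(\<Sum>k\<in>UNIV. p k i) = c i" if "i \<in> I" for i
  proof -
    define P :: "real^'m^'m" where "P = (\<chi> k. e k)"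
    have "P ** transpose P = mat 1"
      by (simp add: vec_eq_iff matrix_matrix_mult_def transpose_def P_def mat_def on flip: inner_vec_def[where 'a=real, simplified])
    then have "transpose P ** P = mat 1" by (rule matrix_left_right_inverse[THEN iffD1])
    then have "(P *v w i) \<bullet> (P *v w i) = w i \<bullet> w i"
      by (simp add: dot_lmul_matrix[symmetric] matrix_vector_mul_assoc flip: transpose_matrix_vector)
    moreover have "P *v w i = (\<chi> k. e k \<bullet> w i)"
      by (simp add: vec_eq_iff matrix_vector_mult_def P_def inner_vec_def)
    ultimately have "(\<Sum>k\<in>UNIV. (e k \<bullet> w i)\<^sup>2) = 1"
      using norm_w[OF that] unfolding norm_eq_1 by (simp add: inner_vec_def[of "\<chi> k. _ k"] power2_eq_square)
    then show ?thesis by (simp add: p_def sum_distrib_left[symmetric])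
  qed
  have "(\<Sum>i\<in>I. c i * ln (t i)) = (\<Sum>i\<in>I. \<Sum>k\<in>UNIV. p k i * ln (t i))"
    by (simp add: pc sum_distrib_right[symmetric])
  also have "\<dots> = (\<Sum>k\<in>UNIV. \<Sum>i\<in>I. p k i * ln (t i))" by (rule sum.swap)
  also have "\<dots> \<le> (\<Sum>k\<in>UNIV. ln (l k))" by (intro sum_mono jensen)
  finally have "exp (\<Sum>i\<in>I. c i * ln (t i)) \<le> exp (\<Sum>k\<in>UNIV. ln (l k))" by simp
  moreover have "exp (\<Sum>i\<in>I. c i * ln (t i)) = (\<Prod>i\<in>I. t i powr c i)"
    unfolding exp_sum[OF finite_I] using t by (intro prod.cong) (fastforce simp: powr_def)+
  moreover have "exp (\<Sum>k\<in>UNIV. ln (l k)) = (\<Prod>k\<in>UNIV. l k)"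
    using lpos by (simp add: exp_sum less_imp_neq[symmetric])
  ultimately show ?thesis using det_orthonormal_eigenbasis[OF lin on eig] unfolding f_def by simp
qed

section \<open>Gaussian integral and change of variables\<close>

lemma nn_integral_std_gaussian:
  "(\<integral>\<^sup>+z. ennreal (exp (- (norm (z::'a::euclidean_space))\<^sup>2 / 2) / sqrt (2 * pi) ^ DIM('a)) \<partial>lborel) = 1"
proof -
  have "exp (- (norm z)\<^sup>2 / 2) / sqrt (2 * pi) ^ DIM('a) = (\<Prod>b\<in>Basis. std_normal_density (z \<bullet> b))" for z :: 'a
  proof -
    have "(norm z)\<^sup>2 = (\<Sum>b\<in>Basis. (z \<bullet> b)\<^sup>2)"
      unfolding power2_norm_eq_inner by (subst euclidean_inner) (simp add: power2_eq_square)
    then show ?thesis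
      by (simp add: std_normal_density_def prod.distrib prod_dividef exp_sum sum_negf[symmetric] sum_divide_distrib power_one_over)
  qed
  moreover have "(\<integral>\<^sup>+x. ennreal (std_normal_density x) \<partial>lborel) = 1"
    using prob_space.emeasure_space_1[OF prob_space_normal_density[of 1 0]] by (simp add: emeasure_density)
  ultimately show ?thesis
    using nn_integral_lborel_prod[of "\<lambda>(b::'a) x. ennreal (std_normal_density x)"]
    by (simp add: prod_ennreal del: std_normal_density_def)
qed

lemma nn_integral_eq_integral_on:
  fixes h :: "'a::euclidean_space \<Rightarrow> real"
  assumes h: "h absolutely_integrable_on S" and nn: "\<And>x. x \<in> S \<Longrightarrow> h x \<ge> 0"
  shows "(\<integral>\<^sup>+x. ennreal (indicator S x * h x) \<partial>lebesgue) = ennreal (integral S h)"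
proof -
  have "(\<integral>\<^sup>+x. ennreal (indicator S x * h x) \<partial>lebesgue) = ennreal (integral\<^sup>L lebesgue (\<lambda>x. indicator S x * h x))"
    using h nn unfolding set_integrable_def
    by (intro nn_integral_eq_integral) (auto split: split_indicator)
  then show ?thesis using set_lebesgue_integral_eq_integral(2)[OF h]
    by (simp add: set_lebesgue_integral_def)
qed

text \<open>
  The injective change of variables formula for a nonnegative integrand that is integrable on the whole
  space, in the form of nonnegative integrals. Scalar functions are passed through one-dimensional vectors.
\<close>

lemma nn_integral_change_of_variables:
  fixes g :: "real^'m::{finite,wellorder} \<Rightarrow> real^'m::_" and f :: "real^'m::_ \<Rightarrow> real"
  assumes S: "S \<in> sets lebesgue"
    and der: "\<And>x. x \<in> S \<Longrightarrow> (g has_derivative g' x) (at x within S)"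
    and inj: "inj_on g S"
    and f: "f \<in> borel_measurable borel" "\<And>z. f z \<ge> 0" "(\<integral>\<^sup>+z. ennreal (f z) \<partial>lborel) < \<infinity>"
  shows "(\<lambda>x. \<bar>det (matrix (g' x))\<bar> * f (g x)) absolutely_integrable_on S"
    and "(\<integral>\<^sup>+x. ennreal (indicator S x * (\<bar>det (matrix (g' x))\<bar> * f (g x))) \<partial>lebesgue)
      = (\<integral>\<^sup>+z. ennreal (indicator (g ` S) z * f z) \<partial>lebesgue)"
proof -
  let ?D = "\<lambda>x. \<bar>det (matrix (g' x))\<bar> * f (g x)"
  let ?vec = "vec :: real \<Rightarrow> real^1"
  have "g ` S \<in> sets lebesgue"
    using S der by (intro differentiable_image_in_sets_lebesgue) (auto simp: differentiable_on_def differentiable_def)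
  moreover have "integrable lebesgue f"
  proof -
    have "integrable lborel f" using f by (intro integrableI_nonneg) auto
    then show ?thesis using f(1) by (subst integrable_completion) auto
  qed
  ultimately have F: "f absolutely_integrable_on g ` S"
    unfolding set_integrable_def by (intro integrable_mult_indicator)
  have "(?vec \<circ> f) absolutely_integrable_on g ` S \<and> integral (g ` S) (?vec \<circ> f) = ?vec (integral (g ` S) f)"
    using F integral_on_1_eq[of "g ` S" "?vec \<circ> f"] by (simp add: absolutely_integrable_on_1_iff o_def)
  from has_absolute_integral_change_of_variables[OF S der inj, THEN iffD2, OF _ this]
  have D: "(\<lambda>x. \<bar>det (matrix (g' x))\<bar> *\<^sub>R (?vec \<circ> f) (g x)) absolutely_integrable_on S"
    "integral S (\<lambda>x. \<bar>det (matrix (g' x))\<bar> *\<^sub>R (?vec \<circ> f) (g x)) = ?vec (integral (g ` S) f)"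
    by auto
  have v: "(\<lambda>x. \<bar>det (matrix (g' x))\<bar> *\<^sub>R (?vec \<circ> f) (g x)) = (\<lambda>x. ?vec (?D x))"
    by (auto simp: vec_eq_iff)
  show 1: "?D absolutely_integrable_on S"
    using D(1) unfolding v by (simp add: absolutely_integrable_on_1_iff)
  have "integral S ?D = integral (g ` S) f"
    using D(2) integral_on_1_eq[of S "\<lambda>x. ?vec (?D x)"] unfolding v by (simp add: vec_eq_iff)
  then show "(\<integral>\<^sup>+x. ennreal (indicator S x * ?D x) \<partial>lebesgue)
      = (\<integral>\<^sup>+z. ennreal (indicator (g ` S) z * f z) \<partial>lebesgue)"
    using nn_integral_eq_integral_on[OF 1] nn_integral_eq_integral_on[OF F] f(2) by simp
qed

section \<open>The exponential integral over the cone of a frame\<close>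

locale vec_unit_frame = unit_frame I w c
  for I :: "'i set" and w :: "'i \<Rightarrow> real^'m::{finite,wellorder}" and c :: "'i \<Rightarrow> real"
begin

definition gauss :: "real^'m::_ \<Rightarrow> real" where
  "gauss z = exp (- (norm z)\<^sup>2 / 2) / sqrt (2 * pi) ^ DIM(real^'m::_)"

definition cone_weight :: "real^'m::_ \<Rightarrow> real" where
  "cone_weight y = indicator cone y * exp (- (\<Sum>i\<in>I. c i * (y \<bullet> w i)))"

text \<open>
  The standard Gaussian density pulled back along \<open>transport\<close>. Its integral is at most 1 since \<open>transport\<close>
  is injective, and it dominates \<open>cone_weight\<close>.
\<close>

definition pullback :: "real^'m::_ \<Rightarrow> real" where
  "pullback y = indicator cone y * (\<bar>det (matrix (transport_deriv y))\<bar> * gauss (transport y))"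

lemma gauss_pos: "gauss z > 0" by (simp add: gauss_def)

lemma gauss_measurable: "gauss \<in> borel_measurable borel"
  unfolding gauss_def[abs_def] by measurable

lemma pullback_measurable: "pullback \<in> borel_measurable lebesgue"
  and nn_integral_pullback:
    "(\<integral>\<^sup>+y. ennreal (pullback y) \<partial>lebesgue) = (\<integral>\<^sup>+z. ennreal (indicator (transport ` cone) z * gauss z) \<partial>lebesgue)"
proof -
  have S: "cone \<in> sets lebesgue" using open_cone by simp
  have der: "(transport has_derivative transport_deriv y) (at y within cone)" if "y \<in> cone" for y
    using has_derivative_transport[OF that] by (rule has_derivative_at_withinI)
  have "(\<integral>\<^sup>+z. ennreal (gauss z) \<partial>lborel) < \<infinity>"
    unfolding gauss_def nn_integral_std_gaussian by simp
  note * = nn_integral_change_of_variables[OF S der inj_transport gauss_measurable less_imp_le[OF gauss_pos] this]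
  show "pullback \<in> borel_measurable lebesgue"
    using *(1) unfolding set_integrable_def pullback_def[abs_def] by (simp add: borel_measurable_integrable)
  show "(\<integral>\<^sup>+y. ennreal (pullback y) \<partial>lebesgue) = (\<integral>\<^sup>+z. ennreal (indicator (transport ` cone) z * gauss z) \<partial>lebesgue)"
    using *(2) unfolding pullback_def .
qed

lemma nn_integral_pullback_le: "(\<integral>\<^sup>+y. ennreal (pullback y) \<partial>lebesgue) \<le> 1"
proof -
  have "(\<integral>\<^sup>+y. ennreal (pullback y) \<partial>lebesgue) \<le> (\<integral>\<^sup>+z. ennreal (gauss z) \<partial>lebesgue)"
    unfolding nn_integral_pullback using gauss_pos
    by (intro nn_integral_mono) (auto split: split_indicator simp: less_imp_le)
  also have "\<dots> = 1" unfolding nn_integral_completion gauss_def by (rule nn_integral_std_gaussian)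
  finally show ?thesis .
qed

lemma cone_weight_measurable: "cone_weight \<in> borel_measurable borel"
  unfolding cone_weight_def[abs_def] using open_cone
  by (intro borel_measurable_times borel_measurable_indicator borel_measurable_continuous_onI)
    (auto intro!: continuous_intros)

definition deficit :: "real^'m::_ \<Rightarrow> real" where
  "deficit y = defect (\<lambda>i. gaussian_of_exp (y \<bullet> w i))"

text \<open>
  Ball's inequality for the Jacobian of \<open>transport\<close>, keeping the loss in the norm inequality as an
  explicit factor for the discussion of equality.
\<close>

lemma cone_weight_le: "cone_weight y \<le> exp (- deficit y / 2) * pullback y"
proof (cases "y \<in> cone")
  case True
  have "(\<Prod>i\<in>I. stretch i y powr c i) \<le> det (matrix (transport_deriv y))"
    unfolding transport_deriv_def[abs_def]
    by (rule frame_det_ge) (auto simp: unit_frame_axioms stretch_pos)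
  then have *: "(\<Prod>i\<in>I. stretch i y powr c i) \<le> \<bar>det (matrix (transport_deriv y))\<bar>" by linarith
  have "cone_weight y = gauss (transport y) * exp (- deficit y / 2) * (\<Prod>i\<in>I. stretch i y powr c i)"
    using True density_transport[OF True] by (simp add: cone_weight_def gauss_def deficit_def)
  also have "\<dots> \<le> gauss (transport y) * exp (- deficit y / 2) * \<bar>det (matrix (transport_deriv y))\<bar>"
    using * gauss_pos by (intro mult_left_mono) (auto intro!: mult_nonneg_nonneg simp: less_imp_le)
  finally show ?thesis using True by (simp add: pullback_def mult_ac)
qed (simp add: cone_weight_def pullback_def)

lemma pullback_nonneg: "pullback y \<ge> 0"
  using gauss_pos by (auto simp: pullback_def less_imp_le)

lemma deficit_nonneg: "deficit y \<ge> 0"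
  unfolding deficit_def by (rule defect_nonneg)

lemma cone_weight_le_pullback: "cone_weight y \<le> pullback y"
proof -
  have "exp (- deficit y / 2) * pullback y \<le> 1 * pullback y"
    using deficit_nonneg pullback_nonneg by (intro mult_right_mono) auto
  then show ?thesis using cone_weight_le[of y] by simp
qed

text \<open>
  The Brascamp-Lieb inequality for exponential functions.
\<close>

theorem nn_integral_cone_weight_le: "(\<integral>\<^sup>+y. ennreal (cone_weight y) \<partial>lborel) \<le> 1"
proof -
  have "(\<integral>\<^sup>+y. ennreal (cone_weight y) \<partial>lborel) = (\<integral>\<^sup>+y. ennreal (cone_weight y) \<partial>lebesgue)"
    by (simp add: nn_integral_completion)
  also have "\<dots> \<le> (\<integral>\<^sup>+y. ennreal (pullback y) \<partial>lebesgue)"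
    by (intro nn_integral_mono ennreal_leI cone_weight_le_pullback)
  finally show ?thesis using nn_integral_pullback_le by (rule order_trans)
qed

lemma continuous_on_deficit: "continuous_on cone deficit"
proof -
  have "isCont gaussian_of_exp t" if "t > 0" for t
    using gaussian_of_exp_deriv[OF that] by (rule DERIV_isCont)
  then have "continuous_on {0<..} gaussian_of_exp" by (auto simp: continuous_on_eq_continuous_at)
  then have "continuous_on cone (\<lambda>y. gaussian_of_exp (y \<bullet> w i))" if "i \<in> I" for i
    by (rule continuous_on_compose2) (auto intro!: continuous_intros simp: cone_def that)
  then show ?thesis
    unfolding deficit_def[abs_def] defect_def synth_def by (auto intro!: continuous_intros)
qed

text \<open>
  If no mass is lost, \<open>cone_weight\<close> and \<open>pullback\<close> agree almost everywhere, so the continuous deficit vanishes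
  almost everywhere and hence everywhere on the open cone.
\<close>

lemma transport_inner_if_tight:
  assumes tight: "(\<integral>\<^sup>+y. ennreal (cone_weight y) \<partial>lborel) = 1" and y: "y \<in> cone" and i: "i \<in> I"
  shows "gaussian_of_exp (y \<bullet> w i) = transport y \<bullet> w i"
proof -
  have cm: "cone_weight \<in> borel_measurable lebesgue"
    using cone_weight_measurable by (intro measurable_completion) simp
  have cw0: "cone_weight y \<ge> 0" for y by (simp add: cone_weight_def)
  have 1: "(\<integral>\<^sup>+y. ennreal (cone_weight y) \<partial>lebesgue) = 1" using tight by (simp add: nn_integral_completion)
  have "(\<integral>\<^sup>+y. ennreal (pullback y) \<partial>lebesgue)
    = (\<integral>\<^sup>+y. ennreal (cone_weight y) + ennreal (pullback y - cone_weight y) \<partial>lebesgue)"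
    using cw0 cone_weight_le_pullback by (intro nn_integral_cong) (simp flip: ennreal_plus)
  also have "\<dots> = 1 + (\<integral>\<^sup>+y. ennreal (pullback y - cone_weight y) \<partial>lebesgue)"
    using cm pullback_measurable by (subst nn_integral_add) (auto simp: 1)
  finally have "1 + (\<integral>\<^sup>+y. ennreal (pullback y - cone_weight y) \<partial>lebesgue) \<le> 1 + 0"
    using nn_integral_pullback_le by simp
  then have "(\<integral>\<^sup>+y. ennreal (pullback y - cone_weight y) \<partial>lebesgue) = 0"
    by (subst (asm) ennreal_add_left_cancel_le) auto
  then have "AE y in lebesgue. ennreal (pullback y - cone_weight y) = 0"
    using cm pullback_measurable by (subst (asm) nn_integral_0_iff_AE) auto
  then have "AE y in lebesgue. y \<notin> {y\<in>cone. deficit y > 0}"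
  proof eventually_elim
    case (elim y)
    then have eq: "pullback y = cone_weight y" using cone_weight_le_pullback[of y] by (simp add: ennreal_eq_0_iff)
    show ?case
    proof
      assume *: "y \<in> {y\<in>cone. deficit y > 0}"
      then have "cone_weight y > 0" by (simp add: cone_weight_def)
      moreover have "exp (- deficit y / 2) < 1" using * by simp
      ultimately have "exp (- deficit y / 2) * cone_weight y < 1 * cone_weight y" by (intro mult_strict_right_mono)
      then show False using cone_weight_le[of y] eq by simp
    qed
  qed
  moreover have op: "open {y\<in>cone. deficit y > 0}"
    using continuous_open_preimage[OF continuous_on_deficit open_cone, of "{0<..}"]
    by (simp add: vimage_def Int_def)
  ultimately have "{y\<in>cone. deficit y > 0} \<in> null_sets lebesgue"
    by (subst AE_iff_null_sets) auto
  then have "negligible {y\<in>cone. deficit y > 0}" by (simp add: negligible_iff_null_sets)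
  then have "{y\<in>cone. deficit y > 0} = {}" using op open_not_negligible by blast
  then have "deficit y = 0" using y deficit_nonneg[of y] by force
  then show ?thesis using i unfolding deficit_def defect_eq_0_iff transport_def by blast
qed

text \<open>
  In the tight case \<open>gaussian_of_exp (y \<bullet> w i)\<close> is linear in \<open>w i\<close>: it is the inner product with
  \<open>transport y\<close>. Approach a point of the boundary of the cone where only the \<open>i\<close>-th coefficient vanishes.
  The inner products of \<open>transport\<close> with the other vectors, and so with their whole span, converge, while
  the \<open>i\<close>-th one tends to minus infinity.
\<close>

lemma not_in_span_if_tight:
  assumes tight: "(\<integral>\<^sup>+y. ennreal (cone_weight y) \<partial>lborel) = 1" and i: "i \<in> I"
    and y: "y \<bullet> w i = 0" "\<And>j. j \<in> I - {i} \<Longrightarrow> y \<bullet> w j > 0"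
  shows "w i \<notin> span (w ` (I - {i}))"
proof
  assume wi: "w i \<in> span (w ` (I - {i}))"
  define p where "p s = y + s *\<^sub>R w i" for s :: real
  have lim_inner: "((\<lambda>s. p s \<bullet> x) \<longlongrightarrow> y \<bullet> x) (at_right 0)" for x
    unfolding p_def by (auto intro!: tendsto_eq_intros)
  have pi: "p s \<bullet> w i = s" for s using y(1) norm_w[OF i] by (simp add: p_def inner_add_left norm_eq_1)
  have "eventually (\<lambda>s. \<forall>j\<in>I. p s \<bullet> w j > 0) (at_right 0)"
  proof (subst eventually_ball_finite_distrib[OF finite_I], intro ballI)
    fix j assume j: "j \<in> I"
    show "eventually (\<lambda>s. p s \<bullet> w j > 0) (at_right 0)"
    proof (cases "j = i")
      case True
      then show ?thesis by (simp add: pi eventually_at_right_less)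
    next
      case False
      then show ?thesis using lim_inner[of "w j"] y(2)[of j] j by (intro order_tendstoD) auto
    qed
  qed
  then have ev: "eventually (\<lambda>s. p s \<in> cone) (at_right 0)" by (simp add: cone_def)
  have "\<exists>l. ((\<lambda>s. transport (p s) \<bullet> x) \<longlongrightarrow> l) (at_right 0)" if "x \<in> span (w ` (I - {i}))" for x
    using that
  proof (induction rule: span_induct_alt)
    case base
    then show ?case by auto
  next
    case (step a b z)
    then obtain j where j: "j \<in> I - {i}" "b = w j" by auto
    have "isCont gaussian_of_exp (y \<bullet> b)"
      using gaussian_of_exp_deriv[OF y(2)] j by (auto intro: DERIV_isCont)
    then have "((\<lambda>s. gaussian_of_exp (p s \<bullet> b)) \<longlongrightarrow> gaussian_of_exp (y \<bullet> b)) (at_right 0)"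
      using lim_inner by (rule isCont_tendsto_compose)
    moreover have "eventually (\<lambda>s. gaussian_of_exp (p s \<bullet> b) = transport (p s) \<bullet> b) (at_right 0)"
      using ev by eventually_elim (use transport_inner_if_tight[OF tight] j in auto)
    ultimately have "((\<lambda>s. transport (p s) \<bullet> b) \<longlongrightarrow> gaussian_of_exp (y \<bullet> b)) (at_right 0)"
      by (rule Lim_transform_eventually)
    moreover obtain l where "((\<lambda>s. transport (p s) \<bullet> z) \<longlongrightarrow> l) (at_right 0)" using step by blast
    ultimately have "((\<lambda>s. transport (p s) \<bullet> (a *\<^sub>R b + z)) \<longlongrightarrow> a * gaussian_of_exp (y \<bullet> b) + l) (at_right 0)"
      unfolding inner_add_right inner_scaleR_right by (intro tendsto_intros)
    then show ?case by blast
  qed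
  from this[OF wi] obtain l where l: "((\<lambda>s. transport (p s) \<bullet> w i) \<longlongrightarrow> l) (at_right 0)" by blast
  have "eventually (\<lambda>s. transport (p s) \<bullet> w i > l - 1) (at_right 0)" using l by (rule order_tendstoD) simp
  moreover have "eventually (\<lambda>s. s < exp_of_gaussian (l - 1)) (at_right 0)"
    by (rule order_tendstoD[OF tendsto_ident_at]) (rule exp_of_gaussian_pos)
  moreover have "eventually (\<lambda>s. (0::real) < s) (at_right 0)" by (rule eventually_at_right_less)
  ultimately have "eventually (\<lambda>s::real. False) (at_right 0)" using ev
  proof eventually_elim
    case (elim s)
    then have "gaussian_of_exp s < gaussian_of_exp (exp_of_gaussian (l - 1))"
      by (subst gaussian_of_exp_less_iff) auto
    moreover have "gaussian_of_exp s = transport (p s) \<bullet> w i"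
      using transport_inner_if_tight[OF tight elim(4) i] by (simp add: pi)
    ultimately show ?case using elim(1) by (simp add: gaussian_of_exp_inverse)
  qed
  then show False by simp
qed

text \<open>
  For an orthonormal frame no inequality is lossy: \<open>transport\<close> acts separately on the coordinates, its
  Jacobian is the product of the stretches, and it maps the cone onto the whole space.
\<close>

lemma tight_if_irredundant:
  assumes irr: "\<And>i. i \<in> I \<Longrightarrow> w i \<notin> span (w ` (I - {i}))"
  shows "(\<integral>\<^sup>+y. ennreal (cone_weight y) \<partial>lborel) = 1"
proof -
  note c1 = orthonormal_if_irredundant(1)[OF irr]
  have on: "w i \<bullet> w j = (if i = j then 1 else 0)" if "i \<in> I" "j \<in> I" for i j
    using orthonormal_if_irredundant(2)[OF irr, of j i] that norm_w by (auto simp: norm_eq_1)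
  have synth_inner: "synth s \<bullet> w j = s j" if "j \<in> I" for s j
    using that finite_I by (simp add: synth_def inner_sum_left on c1 if_distrib cong: if_cong sum.cong)
  have "card I = CARD('m)" using card_irredundant[OF irr] by simp
  then obtain e where e: "bij_betw e (UNIV :: 'm set) I"
    using finite_I finite_same_card_bij by (metis finite_class.finite_UNIV)
  have eI: "e k \<in> I" for k using e by (auto simp: bij_betw_def)
  have einj: "e k = e l \<longleftrightarrow> k = l" for k l using e by (auto simp: bij_betw_def inj_on_def)
  have det: "det (matrix (transport_deriv y)) = (\<Prod>i\<in>I. stretch i y powr c i)" for y
  proof -
    have lin: "linear (transport_deriv y)" unfolding transport_deriv_def synth_def
      by (intro linearI) (auto simp: inner_add algebra_simps sum.distrib scaleR_sum_right)
    have "det (matrix (transport_deriv y)) = (\<Prod>k\<in>UNIV. stretch (e k) y)"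
    proof (rule det_orthonormal_eigenbasis[OF lin])
      show "w (e i) \<bullet> w (e j) = (if i = j then 1 else 0)" for i j by (simp add: on eI einj)
      show "transport_deriv y (w (e k)) = stretch (e k) y *\<^sub>R w (e k)" for k
        unfolding transport_deriv_def synth_def
        using finite_I eI[of k] by (simp add: on c1 if_distrib if_distribR cong: if_cong sum.cong)
    qed
    also have "\<dots> = (\<Prod>i\<in>I. stretch i y)" using e by (rule prod.reindex_bij_betw)
    also have "\<dots> = (\<Prod>i\<in>I. stretch i y powr c i)"
      using stretch_pos by (intro prod.cong) (auto simp: c1 less_imp_le)
    finally show ?thesis .
  qed
  have "cone_weight y = pullback y" for y
  proof (cases "y \<in> cone")
    case True
    have "deficit y = 0" unfolding deficit_def defect_eq_0_iff by (simp add: synth_inner)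
    moreover have "(\<Prod>i\<in>I. stretch i y powr c i) > 0"
      using stretch_pos by (intro prod_pos) (auto simp: less_imp_neq[symmetric])
    ultimately show ?thesis using True density_transport[OF True]
      by (simp add: cone_weight_def pullback_def det deficit_def gauss_def)
  qed (simp add: cone_weight_def pullback_def)
  then have "(\<integral>\<^sup>+y. ennreal (cone_weight y) \<partial>lborel) = (\<integral>\<^sup>+y. ennreal (pullback y) \<partial>lebesgue)"
    by (simp add: nn_integral_completion)
  also have "transport ` cone = UNIV"
  proof -
    have "z \<in> transport ` cone" for z
    proof
      let ?y = "synth (\<lambda>i. exp_of_gaussian (z \<bullet> w i))"
      show "?y \<in> cone" by (auto simp: cone_def synth_inner exp_of_gaussian_pos)
      have "transport ?y = synth (\<lambda>i. z \<bullet> w i)"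
        unfolding transport_def synth_def[of "\<lambda>i. gaussian_of_exp (_ i)"] synth_def[of "\<lambda>i. z \<bullet> w i"]
        by (intro sum.cong refl) (simp add: synth_inner gaussian_of_exp_inverse)
      then show "z = transport ?y" by (simp add: synth_def frame)
    qed
    then show ?thesis by auto
  qed
  then have "(\<integral>\<^sup>+y. ennreal (pullback y) \<partial>lebesgue) = (\<integral>\<^sup>+z. ennreal (gauss z) \<partial>lebesgue)"
    unfolding nn_integral_pullback by simp
  also have "\<dots> = 1" unfolding nn_integral_completion gauss_def by (rule nn_integral_std_gaussian)
  finally show ?thesis .
qed

end

section \<open>Adding one coordinate\<close>

text \<open>
  The coordinates of the space with one more dimension are indexed by \<open>option\<close>. The change of variables
  formula refers to a well-ordered index type; an arbitrary enumeration provides the order.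
\<close>

instantiation option :: (finite) wellorder
begin

definition less_eq_option :: "'a option \<Rightarrow> 'a option \<Rightarrow> bool" where
  "less_eq_option x y \<longleftrightarrow> to_nat x \<le> to_nat y"

definition less_option :: "'a option \<Rightarrow> 'a option \<Rightarrow> bool" where
  "less_option x y \<longleftrightarrow> to_nat x < to_nat y"

instance
proof
  fix x y z :: "'a option"
  show "x < y \<longleftrightarrow> x \<le> y \<and> \<not> y \<le> x" by (simp add: less_option_def less_eq_option_def less_le_not_le)
  show "x \<le> x" by (simp add: less_eq_option_def)
  show "x \<le> z" if "x \<le> y" "y \<le> z" using that unfolding less_eq_option_def by (rule order_trans)
  show "x = y" if "x \<le> y" "y \<le> x"
    using that unfolding less_eq_option_def by (metis antisym from_nat_to_nat)
  show "x \<le> y \<or> y \<le> x" unfolding less_eq_option_def by (rule linear)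
next
  fix P :: "'a option \<Rightarrow> bool" and a :: "'a option"
  assume "\<And>x. (\<And>y. y < x \<Longrightarrow> P y) \<Longrightarrow> P x"
  then show "P a" unfolding less_option_def by (rule measure_induct_rule[of to_nat])
qed

end

definition vcons :: "real \<Rightarrow> real^'n \<Rightarrow> real^('n::finite option)" where
  "vcons r x = (\<chi> k. case k of None \<Rightarrow> r | Some j \<Rightarrow> x $ j)"

lemma sum_UNIV_option: "(\<Sum>k\<in>UNIV. f k) = f None + (\<Sum>j\<in>UNIV. f (Some j))" for f :: "'n::finite option \<Rightarrow> 'a::comm_monoid_add"
  by (simp add: UNIV_option_conv sum.reindex)

lemma prod_UNIV_option: "(\<Prod>k\<in>UNIV. f k) = f None * (\<Prod>j\<in>UNIV. f (Some j))" for f :: "'n::finite option \<Rightarrow> 'a::comm_monoid_mult"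
  by (simp add: UNIV_option_conv prod.reindex)

lemma inner_vcons: "vcons r x \<bullet> vcons s y = r * s + x \<bullet> y"
  by (simp add: inner_vec_def vcons_def sum_UNIV_option)

lemma vcons_eq_iff: "vcons r x = vcons s y \<longleftrightarrow> r = s \<and> x = y"
  by (auto simp: vec_eq_iff vcons_def split: option.splits)

lemma vcons_cases: obtains r x where "y = vcons r x"
  by (rule that[of "y $ None" "\<chi> j. y $ Some j"]) (auto simp: vec_eq_iff vcons_def split: option.splits)

lemma vcons_add: "vcons r x + vcons s y = vcons (r + s) (x + y)"
  by (auto simp: vec_eq_iff vcons_def split: option.splits)

lemma vcons_scale: "a *\<^sub>R vcons r x = vcons (a * r) (a *\<^sub>R x)"
  by (auto simp: vec_eq_iff vcons_def split: option.splits)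

lemma vcons_sum: "(\<Sum>i\<in>I. vcons (r i) (x i)) = vcons (\<Sum>i\<in>I. r i) (\<Sum>i\<in>I. x i)"
  by (induction I rule: infinite_finite_induct) (auto simp: vcons_add vec_eq_iff vcons_def split: option.splits)

lemma prod_Basis_vec: "(\<Prod>b\<in>Basis. f (x \<bullet> b)) = (\<Prod>i\<in>UNIV. f (x $ i))" for x :: "real^'k"
proof -
  have B: "Basis = range (\<lambda>i::'k. axis i (1::real))" by (auto simp: Basis_vec_def)
  have "inj (\<lambda>i::'k. axis i (1::real))" by (auto simp: inj_on_def axis_eq_axis)
  then show ?thesis unfolding B by (subst prod.reindex) (simp_all add: inner_axis)
qed

lemma continuous_on_vcons:
  fixes S :: "(real \<times> (real^'n)) set"
  shows "continuous_on S (\<lambda>p. vcons (fst p) (snd p))"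
  unfolding vcons_def
proof (rule continuous_on_vec_lambda)
  show "continuous_on S (\<lambda>p. case k of None \<Rightarrow> fst p | Some j \<Rightarrow> snd p $ j)" for k
    by (cases k) (auto intro!: continuous_intros)
qed

text \<open>
  Boxes split as products, and Lebesgue measure is determined by its values on boxes.
\<close>

lemma lborel_vcons:
  "(lborel :: (real^('n::finite option)) measure) = distr (lborel \<Otimes>\<^sub>M lborel) borel (\<lambda>p. vcons (fst p) (snd p))"
proof (rule lborel_eqI)
  let ?v = "\<lambda>p :: real \<times> (real^'n). vcons (fst p) (snd p)"
  have m: "?v \<in> measurable (lborel \<Otimes>\<^sub>M lborel) borel"
    unfolding lborel_prod by (simp add: borel_measurable_continuous_onI[OF continuous_on_vcons])
  fix l u :: "real^('n::finite option)" assume lu: "\<And>b. b \<in> Basis \<Longrightarrow> l \<bullet> b \<le> u \<bullet> b"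
  have le: "l $ k \<le> u $ k" for k using lu[of "axis k 1"] by (simp add: inner_axis)
  let ?l = "\<chi> j. l $ Some j" and ?u = "\<chi> j. u $ Some j"
  have "?v -` box l u \<inter> space (lborel \<Otimes>\<^sub>M lborel) = {l $ None<..<u $ None} \<times> box ?l ?u"
  proof -
    have "vcons r x \<in> box l u \<longleftrightarrow> r \<in> {l $ None<..<u $ None} \<and> x \<in> box ?l ?u" for r x
      unfolding mem_box_cart by (simp add: vcons_def split: option.splits) (metis option.exhaust option.simps(4,5))
    then show ?thesis by (auto simp: space_pair_measure)
  qed
  then have "emeasure (distr (lborel \<Otimes>\<^sub>M lborel) borel ?v) (box l u)
      = emeasure (lborel \<Otimes>\<^sub>M lborel) ({l $ None<..<u $ None} \<times> box ?l ?u)"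
    using m by (subst emeasure_distr) auto
  also have "\<dots> = emeasure lborel {l $ None<..<u $ None} * emeasure lborel (box ?l ?u)"
    by (rule lborel.emeasure_pair_measure_Times) auto
  also have "emeasure lborel (box ?l ?u) = (\<Prod>b\<in>Basis. (?u - ?l) \<bullet> b)"
  proof (rule emeasure_lborel_box)
    show "?l \<bullet> b \<le> ?u \<bullet> b" if "b \<in> Basis" for b
      using that le by (auto simp: Basis_vec_def inner_axis)
  qed
  also have "\<dots> = (\<Prod>j\<in>UNIV. u $ Some j - l $ Some j)"
    using prod_Basis_vec[of "\<lambda>x. x" "?u - ?l"] by simp
  finally show "emeasure (distr (lborel \<Otimes>\<^sub>M lborel) borel ?v) (box l u) = (\<Prod>b\<in>Basis. (u - l) \<bullet> b)"
    using le prod_Basis_vec[of "\<lambda>x. x" "u - l"]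
    by (simp add: prod_UNIV_option ennreal_mult prod_nonneg)
qed simp

lemma nn_integral_vcons:
  fixes f :: "real^('n::finite option) \<Rightarrow> ennreal"
  assumes f: "f \<in> borel_measurable borel"
  shows "(\<integral>\<^sup>+y. f y \<partial>lborel) = (\<integral>\<^sup>+r. \<integral>\<^sup>+x. f (vcons r x) \<partial>lborel \<partial>lborel)"
proof -
  let ?v = "\<lambda>p :: real \<times> (real^'n). vcons (fst p) (snd p)"
  have m: "?v \<in> measurable (lborel \<Otimes>\<^sub>M lborel) borel"
    unfolding lborel_prod by (simp add: borel_measurable_continuous_onI[OF continuous_on_vcons])
  have "(\<integral>\<^sup>+y. f y \<partial>lborel) = (\<integral>\<^sup>+p. f (?v p) \<partial>(lborel \<Otimes>\<^sub>M lborel))"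
    by (subst lborel_vcons) (simp add: nn_integral_distr[OF m] f)
  also have "\<dots> = (\<integral>\<^sup>+r. \<integral>\<^sup>+x. f (?v (r, x)) \<partial>lborel \<partial>lborel)"
    by (rule lborel.nn_integral_fst[symmetric]) (rule measurable_compose[OF m f])
  finally show ?thesis by simp
qed

section \<open>Volume of the polar of a finite isotropic set\<close>

text \<open>
  The bound of the theorem, with square roots in place of half-integral powers.
\<close>

definition max_volume :: "nat \<Rightarrow> real" where
  "max_volume n = sqrt n ^ n * sqrt (n + 1) ^ (n + 1) / fact n"

lemma max_volume_pos: "n > 0 \<Longrightarrow> max_volume n > 0"
  by (simp add: max_volume_def)

lemma max_volume_powr:
  assumes "n > 0"
  shows "max_volume n = real n powr (real n / 2) * real (n + 1) powr (real (n + 1) / 2) / fact n"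
proof -
  have "real m powr (real m / 2) = sqrt m ^ m" if "m > 0" for m
    using that by (simp add: powr_half_sqrt[symmetric] powr_realpow[symmetric] powr_powr)
  from this[of n] this[of "n + 1"] show ?thesis using assms by (simp add: max_volume_def)
qed

lemma nn_integral_power_exp:
  assumes "a > 0"
  shows "(\<integral>\<^sup>+r. ennreal (indicator {0<..} r * (r ^ k * exp (- (a * r)))) \<partial>lborel) = ennreal (fact k / a ^ (k + 1))"
proof -
  have 1: "(\<integral>\<^sup>+r. ennreal (erlang_density k a r) \<partial>lborel) = 1"
    using prob_space.emeasure_space_1[OF prob_space_erlang_density[OF assms, of k]]
    by (simp add: emeasure_density)
  \<comment> \<open>The two integrands are proportional except at 0.\<close>
  have *: "AE r in lborel. ennreal (indicator {0<..} r * (r ^ k * exp (- (a * r))))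
     = ennreal (fact k / a ^ (k + 1)) * ennreal (erlang_density k a r)"
    using AE_lborel_singleton[of "0::real"]
  proof eventually_elim
    case (elim r)
    then show ?case using assms
      by (auto simp: erlang_density_def ennreal_mult[symmetric] field_simps split: split_indicator)
  qed
  from * have "(\<integral>\<^sup>+r. ennreal (indicator {0<..} r * (r ^ k * exp (- (a * r)))) \<partial>lborel)
    = (\<integral>\<^sup>+r. ennreal (fact k / a ^ (k + 1)) * ennreal (erlang_density k a r) \<partial>lborel)"
    by (rule nn_integral_cong_AE)
  then show ?thesis by (simp add: nn_integral_cmult 1)
qed

lemma ennreal_inverse_mult_iff:
  assumes "a > 0" shows "ennreal (1 / a) * x \<le> 1 \<longleftrightarrow> x \<le> ennreal a"
    "ennreal (1 / a) * x = 1 \<longleftrightarrow> x = ennreal a"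
proof -
  have "x = ennreal a * (ennreal (1 / a) * x)"
    using assms by (simp add: mult.assoc[symmetric] ennreal_mult[symmetric])
  moreover have "ennreal (1 / a) * ennreal a = 1" using assms by (simp add: ennreal_mult[symmetric])
  ultimately show "ennreal (1 / a) * x = 1 \<longleftrightarrow> x = ennreal a" by (metis mult.right_neutral)
  show "ennreal (1 / a) * x \<le> 1 \<longleftrightarrow> x \<le> ennreal a"
    by (metis \<open>ennreal (1 / a) * ennreal a = 1\<close> \<open>x = ennreal a * (ennreal (1 / a) * x)\<close> mult.right_neutral mult_left_mono zero_le)
qed

lemma inner_unit_less_1:
  fixes u v :: "'a::real_inner"
  assumes "norm u = 1" "norm v = 1" "u \<noteq> v" shows "u \<bullet> v < 1"
proof -
  have "0 < (u - v) \<bullet> (u - v)" using assms(3) by simp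
  also have "\<dots> = 2 - 2 * (u \<bullet> v)"
    using assms(1,2) by (simp add: inner_diff inner_commute norm_eq_1)
  finally show ?thesis by simp
qed

text \<open>
  A finitely supported isotropic measure with centroid 0, in the role of \<open>Z\<close>. The dimension is kept as a
  real number \<open>n\<close>, since it mostly appears under square roots.
\<close>

locale centered_unit_frame = unit_frame U "\<lambda>u. u" c
  for U :: "(real^'n) set" and c :: "real^'n \<Rightarrow> real" +
  fixes n :: real
  assumes n_eq: "n = real CARD('n)" and centered: "(\<Sum>u\<in>U. c u *\<^sub>R u) = 0"
begin

text \<open>
  The lift of the unit sphere into one more dimension. With these coefficients and \<open>lift_weight\<close> the lifted
  vectors have norm 1, and isotropy and centring of \<open>U\<close> together amount to isotropy of the lift. Distinct
  vertices of an inscribed regular simplex become orthogonal. The minus sign makes the slices of the lifted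
  cone multiples of the polar body.
\<close>

definition lift :: "real^'n \<Rightarrow> real^('n option)" where
  "lift u = vcons (1 / sqrt (n + 1)) (- (sqrt n / sqrt (n + 1)) *\<^sub>R u)"

definition lift_weight :: "real^'n \<Rightarrow> real" where
  "lift_weight u = (n + 1) / n * c u"

lemma n_pos [simp]: "n > 0" "n + 1 > 0" "n \<noteq> 0" "n + 1 \<noteq> 0" "1 + n \<noteq> 0"
    "\<bar>n\<bar> = n" "\<bar>n + 1\<bar> = n + 1" "\<bar>1 + n\<bar> = 1 + n" "\<not> n + 1 < 0"
    "sqrt n > 0" "sqrt (n + 1) > 0" "n \<ge> 0" "n + 1 \<ge> 0"
  by (simp_all add: n_eq add_pos_pos)

lemma sum_c_inner: "(\<Sum>u\<in>U. c u * (x \<bullet> u)) = 0"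
  using arg_cong[OF centered, of "\<lambda>v. x \<bullet> v"] by (simp add: inner_sum_right)

lemma sum_c_n: "(\<Sum>u\<in>U. c u) = n"
  using sum_c by (simp add: n_eq)

lemma inner_lift: "vcons r x \<bullet> lift u = (r - sqrt n * (x \<bullet> u)) / sqrt (n + 1)"
  by (simp add: lift_def inner_vcons diff_divide_distrib)

lemma sum_lift_weight_inner: "(\<Sum>u\<in>U. lift_weight u * (vcons r x \<bullet> lift u)) = sqrt (n + 1) * r"
proof -
  have "(\<Sum>u\<in>U. lift_weight u * (vcons r x \<bullet> lift u))
     = (n + 1) / n * (r * (\<Sum>u\<in>U. c u) - sqrt n * (\<Sum>u\<in>U. c u * (x \<bullet> u))) / sqrt (n + 1)"
    unfolding sum_distrib_left sum_subtractf[symmetric] sum_divide_distrib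
    by (intro sum.cong refl) (simp add: inner_lift lift_weight_def field_simps)
  also have "\<dots> = (n + 1) / sqrt (n + 1) * r"
    by (simp add: sum_c_n sum_c_inner)
  also have "(n + 1) / sqrt (n + 1) = sqrt (n + 1)" using n_pos(2) by (intro real_div_sqrt) linarith
  finally show ?thesis .
qed

lemma lift_frame: "vec_unit_frame U lift lift_weight"
proof
  show "finite U" by (rule finite_I)
  show "lift_weight u > 0" if "u \<in> U" for u using c_pos[OF that] by (simp add: lift_weight_def)
  show "norm (lift u) = 1" if "u \<in> U" for u
  proof -
    have "u \<bullet> u = 1" using norm_w[OF that] by (simp add: norm_eq_1)
    then have "lift u \<bullet> lift u = 1 / (n + 1) + n / (n + 1)"
      by (simp add: lift_def inner_vcons)
    then show ?thesis unfolding norm_eq_1 by (simp add: add_divide_distrib[symmetric])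
  qed
  show "(\<Sum>u\<in>U. (lift_weight u * (y \<bullet> lift u)) *\<^sub>R lift u) = y" for y
  proof -
    obtain r x where y: "y = vcons r x" by (rule vcons_cases)
    let ?a = "\<lambda>u. lift_weight u * (y \<bullet> lift u)"
    have "(\<Sum>u\<in>U. ?a u *\<^sub>R lift u)
      = vcons ((\<Sum>u\<in>U. ?a u) / sqrt (n + 1)) (- (sqrt n / sqrt (n + 1)) *\<^sub>R (\<Sum>u\<in>U. ?a u *\<^sub>R u))"
      by (simp add: lift_def vcons_scale vcons_sum sum_divide_distrib scaleR_sum_right sum_negf mult.commute)
    moreover have "(\<Sum>u\<in>U. ?a u) / sqrt (n + 1) = r"
      unfolding y sum_lift_weight_inner by simp
    moreover have "(\<Sum>u\<in>U. ?a u *\<^sub>R u) = - (sqrt (n + 1) / sqrt n) *\<^sub>R x"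
    proof -
      have "(\<Sum>u\<in>U. ?a u *\<^sub>R u) = ((n + 1) / n / sqrt (n + 1)) *\<^sub>R
         (r *\<^sub>R (\<Sum>u\<in>U. c u *\<^sub>R u) - sqrt n *\<^sub>R (\<Sum>u\<in>U. (c u * (x \<bullet> u)) *\<^sub>R u))"
        unfolding scaleR_sum_right sum_subtractf[symmetric]
        by (intro sum.cong refl) (simp add: y inner_lift lift_weight_def algebra_simps diff_divide_distrib add_divide_distrib)
      also have "\<dots> = - ((n + 1) / n / sqrt (n + 1) * sqrt n) *\<^sub>R x"
        using frame[of x] by (simp add: centered)
      also have "(n + 1) / n / sqrt (n + 1) * sqrt n = sqrt (n + 1) / sqrt n"
        using real_div_sqrt[of "n + 1"] real_div_sqrt[of n] n_pos(1,2) by (simp add: field_simps)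
      finally show ?thesis .
    qed
    ultimately show ?thesis by (simp add: y vcons_eq_iff)
  qed
qed

sublocale lifted: vec_unit_frame U lift lift_weight
  by (rule lift_frame)

definition open_polar :: "(real^'n) set" where
  "open_polar = {x. \<forall>u\<in>U. x \<bullet> u < 1}"

lemma open_open_polar: "open open_polar"
proof -
  have "open_polar = (\<Inter>u\<in>U. {x. x \<bullet> u < 1})" by (auto simp: open_polar_def)
  then show ?thesis using finite_I by (auto intro!: open_INT open_Collect_less continuous_intros)
qed

lemma U_nonempty: "U \<noteq> {}" using sum_c_n by auto

text \<open>
  Centring excludes \<open>r \<le> 0\<close>: the weighted mean of the numbers \<open>x \<bullet> u\<close> is 0, so they cannot all be negative.
\<close>

lemma cone_slice:
  "vcons r x \<in> lifted.cone \<longleftrightarrow> r > 0 \<and> x \<in> (\<lambda>x. (r / sqrt n) *\<^sub>R x) ` open_polar"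
proof -
  have pos: "sqrt n > 0" "sqrt (n + 1) > 0" by (auto simp: add_pos_pos)
  have iff: "vcons r x \<in> lifted.cone \<longleftrightarrow> (\<forall>u\<in>U. sqrt n * (x \<bullet> u) < r)"
    using pos by (simp add: lifted.cone_def inner_lift zero_less_divide_iff)
  have r: "r > 0" if "\<forall>u\<in>U. sqrt n * (x \<bullet> u) < r"
  proof (rule ccontr)
    assume "\<not> r > 0"
    then have "x \<bullet> u < 0" if "u \<in> U" for u
      using pos \<open>\<forall>u\<in>U. sqrt n * (x \<bullet> u) < r\<close> that by (smt (verit) mult_nonneg_nonneg)
    then have "(\<Sum>u\<in>U. c u * (x \<bullet> u)) < (\<Sum>u\<in>U. 0)"
      using finite_I U_nonempty c_pos by (intro sum_strict_mono) (auto simp: mult_pos_neg)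
    then show False by (simp add: sum_c_inner)
  qed
  have "x \<in> (\<lambda>x. (r / sqrt n) *\<^sub>R x) ` open_polar \<longleftrightarrow> (\<forall>u\<in>U. sqrt n * (x \<bullet> u) < r)" if "r > 0"
  proof
    assume "x \<in> (\<lambda>x. (r / sqrt n) *\<^sub>R x) ` open_polar"
    then show "\<forall>u\<in>U. sqrt n * (x \<bullet> u) < r" using that pos by (auto simp: open_polar_def)
  next
    assume *: "\<forall>u\<in>U. sqrt n * (x \<bullet> u) < r"
    show "x \<in> (\<lambda>x. (r / sqrt n) *\<^sub>R x) ` open_polar"
    proof
      show "x = (r / sqrt n) *\<^sub>R ((sqrt n / r) *\<^sub>R x)" using that pos by simp
      show "(sqrt n / r) *\<^sub>R x \<in> open_polar" using * that by (auto simp: open_polar_def)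
    qed
  qed
  with iff r show ?thesis by blast
qed

text \<open>
  The slice of the cone at height \<open>r\<close> is a copy of the open polar scaled by \<open>r / sqrt n\<close>, and the weight is
  \<open>exp (- sqrt (n + 1) r)\<close> there; the remaining integral over \<open>r\<close> is a Gamma integral.
\<close>

lemma nn_integral_cone_weight:
  "(\<integral>\<^sup>+y. ennreal (lifted.cone_weight y) \<partial>lborel) = ennreal (1 / max_volume CARD('n)) * emeasure lborel open_polar"
proof -
  have bo: "open_polar \<in> sets borel" using open_open_polar by simp
  have *: "(\<integral>\<^sup>+x. ennreal (lifted.cone_weight (vcons r x)) \<partial>lborel)
    = ennreal (1 / sqrt n ^ CARD('n)) * emeasure lborel open_polar
      * ennreal (indicator {0<..} r * (r ^ CARD('n) * exp (- (sqrt (n + 1) * r))))" for r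
  proof (cases "r > 0")
    case True
    let ?S = "(\<lambda>x. (r / sqrt n) *\<^sub>R x) ` open_polar"
    have oS: "open ?S" using open_open_polar True by (intro open_scaling) auto
    have "(\<integral>\<^sup>+x. ennreal (lifted.cone_weight (vcons r x)) \<partial>lborel)
       = (\<integral>\<^sup>+x. ennreal (exp (- (sqrt (n + 1) * r))) * indicator ?S x \<partial>lborel)"
      using True by (intro nn_integral_cong)
        (auto simp: lifted.cone_weight_def cone_slice sum_lift_weight_inner split: split_indicator)
    also have "\<dots> = ennreal (exp (- (sqrt (n + 1) * r))) * emeasure lborel ?S"
      using oS by (subst nn_integral_cmult_indicator) auto
    also have "emeasure lborel ?S = emeasure lebesgue ?S" using oS by simp
    also have "\<dots> = ennreal ((r / sqrt n) ^ CARD('n)) * emeasure lebesgue open_polar"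
      using emeasure_lebesgue_affine[of "r / sqrt n" 0 open_polar] True
        real_sqrt_gt_zero[OF n_pos(1)] by (simp add: ennreal_mult abs_of_pos)
    also have "emeasure lebesgue open_polar = emeasure lborel open_polar" using bo by simp
    also have "ennreal (exp (- (sqrt (n + 1) * r))) * (ennreal ((r / sqrt n) ^ CARD('n)) * emeasure lborel open_polar)
      = ennreal (exp (- (sqrt (n + 1) * r)) * (r / sqrt n) ^ CARD('n)) * emeasure lborel open_polar"
      using True by (subst ennreal_mult) (auto simp: mult.assoc less_imp_le)
    also have "exp (- (sqrt (n + 1) * r)) * (r / sqrt n) ^ CARD('n)
      = 1 / sqrt n ^ CARD('n) * (r ^ CARD('n) * exp (- (sqrt (n + 1) * r)))"
      by (simp add: power_divide)
    also have "ennreal (1 / sqrt n ^ CARD('n) * (r ^ CARD('n) * exp (- (sqrt (n + 1) * r)))) * emeasure lborel open_polar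
      = ennreal (1 / sqrt n ^ CARD('n)) * emeasure lborel open_polar * ennreal (r ^ CARD('n) * exp (- (sqrt (n + 1) * r)))"
      using True by (subst ennreal_mult) (auto simp: mult_ac less_imp_le)
    finally show ?thesis using True by simp
  next
    case False
    then have "lifted.cone_weight (vcons r x) = 0" for x
      by (simp add: lifted.cone_weight_def cone_slice)
    then show ?thesis using False by simp
  qed
  have "(\<integral>\<^sup>+y. ennreal (lifted.cone_weight y) \<partial>lborel)
      = (\<integral>\<^sup>+r. \<integral>\<^sup>+x. ennreal (lifted.cone_weight (vcons r x)) \<partial>lborel \<partial>lborel)"
    using lifted.cone_weight_measurable by (intro nn_integral_vcons) simp
  also have "\<dots> = ennreal (1 / sqrt n ^ CARD('n)) * emeasure lborel open_polar * ennreal (fact CARD('n) / sqrt (n + 1) ^ (CARD('n) + 1))"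
    unfolding * by (subst nn_integral_cmult) (auto simp: nn_integral_power_exp add_pos_pos simp del: power_Suc)
  also have "\<dots> = ennreal (1 / sqrt n ^ CARD('n) * (fact CARD('n) / sqrt (n + 1) ^ (CARD('n) + 1))) * emeasure lborel open_polar"
    by (subst ennreal_mult) (auto simp: mult_ac)
  also have "1 / sqrt n ^ CARD('n) * (fact CARD('n) / sqrt (n + 1) ^ (CARD('n) + 1)) = 1 / max_volume CARD('n)"
    by (simp add: max_volume_def n_eq add.commute)
  finally show ?thesis .
qed

definition polar :: "(real^'n) set" where
  "polar = {x. \<forall>u\<in>U. x \<bullet> u \<le> 1}"

lemma closed_polar: "closed polar"
proof -
  have "polar = (\<Inter>u\<in>U. {x. x \<bullet> u \<le> 1})" by (auto simp: polar_def)
  then show ?thesis by (auto intro!: closed_INT closed_Collect_le continuous_intros)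
qed

text \<open>
  Open and closed polar differ by subsets of finitely many hyperplanes.
\<close>

lemma emeasure_polar: "emeasure lborel polar = emeasure lborel open_polar"
proof -
  let ?N = "\<Union>u\<in>U. {x. u \<bullet> x = 1}"
  have N: "?N \<in> null_sets lborel"
  proof (rule null_sets_UN')
    show "countable U" using finite_I by (rule countable_finite)
    fix u assume "u \<in> U"
    have "negligible {x. u \<bullet> x = 1}" by (rule negligible_hyperplane) simp
    moreover have "{x. u \<bullet> x = 1} \<in> sets borel" by (intro borel_closed closed_hyperplane)
    ultimately show "{x. u \<bullet> x = 1} \<in> null_sets lborel"
      by (simp add: negligible_iff_null_sets null_sets_def)
  qed
  have "polar \<subseteq> open_polar \<union> ?N" by (force simp: polar_def open_polar_def inner_commute)
  then have "emeasure lborel polar \<le> emeasure lborel (open_polar \<union> ?N)"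
    using N open_open_polar by (intro emeasure_mono) auto
  also have "\<dots> = emeasure lborel open_polar"
    using N open_open_polar by (intro emeasure_Un_null_set) auto
  finally show ?thesis
  proof (rule antisym)
    show "emeasure lborel open_polar \<le> emeasure lborel polar"
      using closed_polar by (intro emeasure_mono) (auto simp: polar_def open_polar_def less_imp_le)
  qed
qed

theorem emeasure_polar_le: "emeasure lborel polar \<le> ennreal (max_volume CARD('n))"
  using lifted.nn_integral_cone_weight_le max_volume_pos[of "CARD('n)"]
  unfolding nn_integral_cone_weight emeasure_polar by (simp add: ennreal_inverse_mult_iff(1))

lemma emeasure_polar_eq_iff_tight:
  "emeasure lborel polar = ennreal (max_volume CARD('n)) \<longleftrightarrow> (\<integral>\<^sup>+y. ennreal (lifted.cone_weight y) \<partial>lborel) = 1"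
  using max_volume_pos[of "CARD('n)"]
  unfolding nn_integral_cone_weight emeasure_polar by (simp add: ennreal_inverse_mult_iff(2))

text \<open>
  Every vector of \<open>U\<close> exposes a facet of the lifted cone: at the point with coordinates \<open>sqrt n\<close> and \<open>u\<close> the
  coefficient of \<open>lift v\<close> is a positive multiple of \<open>1 - u \<bullet> v\<close>, which vanishes for \<open>v = u\<close> only. So tightness
  makes the lifted vectors linearly independent, and there are \<open>n + 1\<close> of them.
\<close>

theorem emeasure_polar_eq_iff_card:
  "emeasure lborel polar = ennreal (max_volume CARD('n)) \<longleftrightarrow> card U = CARD('n) + 1"
  unfolding emeasure_polar_eq_iff_tight
proof
  assume tight: "(\<integral>\<^sup>+y. ennreal (lifted.cone_weight y) \<partial>lborel) = 1"
  have "lift u \<notin> span (lift ` (U - {u}))" if u: "u \<in> U" for u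
  proof (rule lifted.not_in_span_if_tight[OF tight u])
    show "vcons (sqrt n) u \<bullet> lift u = 0"
      using norm_w[OF u] by (simp add: inner_lift norm_eq_1)
    show "vcons (sqrt n) u \<bullet> lift v > 0" if "v \<in> U - {u}" for v
      using inner_unit_less_1[of u v] that norm_w u by (auto simp: inner_lift add_pos_pos)
  qed
  from lifted.card_irredundant[OF this] show "card U = CARD('n) + 1" by simp
next
  assume "card U = CARD('n) + 1"
  then have "lift u \<notin> span (lift ` (U - {u}))" if "u \<in> U" for u
    using that by (intro lifted.irredundant_if_card) auto
  then show "(\<integral>\<^sup>+y. ennreal (lifted.cone_weight y) \<partial>lborel) = 1"
    by (rule lifted.tight_if_irredundant)
qed

lemma card_U_ge: "card U \<ge> CARD('n) + 1"
  using lifted.card_ge_dim by simp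

lemma inner_if_card:
  assumes "card U = CARD('n) + 1" "u \<in> U" "v \<in> U" "u \<noteq> v"
  shows "u \<bullet> v = - 1 / n"
proof -
  have "lift u \<notin> span (lift ` (U - {u}))" if "u \<in> U" for u
    using that assms(1) by (intro lifted.irredundant_if_card) auto
  from lifted.orthonormal_if_irredundant(2)[OF this assms(3,2,4)]
  have "lift u \<bullet> lift v = 0" .
  then have "1 / (n + 1) + n / (n + 1) * (u \<bullet> v) = 0"
    by (simp add: lift_def inner_vcons flip: mult.assoc)
  then show ?thesis by (simp add: field_simps)
qed

end

section \<open>Reduction to finitely supported measures\<close>

lemma space_sphere_measure: "sphere_measure Z \<Longrightarrow> space Z = sphere 0 1"
  using sets_eq_imp_space_eq[of Z "restrict_space borel (sphere 0 1)"]
  by (simp add: sphere_measure_def space_restrict_space)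

lemma supp_subset_sphere: "sphere_measure Z \<Longrightarrow> supp Z \<subseteq> sphere 0 1"
  using space_sphere_measure[of Z] by (auto simp: supp_def)

lemma supp_eq: "supp Z = space Z - \<Union>{U. open U \<and> emeasure Z (U \<inter> space Z) = 0}"
  by (auto simp: supp_def zero_less_iff_neq_zero)

lemma compact_supp:
  assumes "sphere_measure Z" shows "compact (supp Z)"
proof -
  have "open (\<Union>{U. open U \<and> emeasure Z (U \<inter> space Z) = 0})" by (rule open_Union) auto
  then show ?thesis unfolding supp_eq space_sphere_measure[OF assms] by (intro compact_diff) auto
qed

text \<open>
  By the Lindelof property, the complement of the support is a countable union of null sets.
\<close>

lemma AE_in_supp:
  fixes Z :: "'a::euclidean_space measure"
  assumes Z: "sphere_measure Z" shows "AE u in Z. u \<in> supp Z"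
proof -
  let ?F = "{U. open U \<and> emeasure Z (U \<inter> space Z) = 0}"
  obtain G where G: "G \<subseteq> ?F" "countable G" "\<Union>G = \<Union>?F"
    by (rule Lindelof[of ?F]) auto
  have "(\<Union>U\<in>G. U \<inter> space Z) \<in> null_sets Z"
  proof (rule null_sets_UN'[OF G(2)])
    fix U assume "U \<in> G"
    then have U: "open U" "emeasure Z (U \<inter> space Z) = 0" using G(1) by auto
    have "U \<inter> space Z \<in> sets Z"
      using Z U(1) unfolding space_sphere_measure[OF Z] by (auto simp: sphere_measure_def sets_restrict_space Int_commute)
    then show "U \<inter> space Z \<in> null_sets Z" using U(2) by auto
  qed
  then have "AE u in Z. u \<notin> (\<Union>U\<in>G. U \<inter> space Z)" by (rule AE_not_in)
  moreover have "AE u in Z. u \<in> space Z" by (rule AE_space)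
  ultimately show ?thesis
  proof eventually_elim
    case (elim u)
    then show ?case using G(3) unfolding supp_eq by auto
  qed
qed

lemma integrable_sphere_measure:
  fixes F :: "'a::euclidean_space \<Rightarrow> 'b::euclidean_space"
  assumes Z: "sphere_measure Z" and F: "continuous_on (sphere 0 1) F"
  shows "integrable Z F"
proof -
  interpret finite_measure Z using Z by (simp add: sphere_measure_def)
  have "F \<in> borel_measurable (restrict_space borel (sphere 0 1))"
    using F by (rule borel_measurable_continuous_on_restrict)
  then have m: "F \<in> borel_measurable Z"
    using Z by (simp add: sphere_measure_def cong: measurable_cong_sets)
  have "bounded (F ` sphere 0 1)" using F by (intro compact_imp_bounded compact_continuous_image) auto
  then obtain B where "\<And>u. u \<in> sphere 0 1 \<Longrightarrow> norm (F u) \<le> B" unfolding bounded_iff by blast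
  then have "AE u in Z. norm (F u) \<le> B" by (intro AE_I2) (simp add: space_sphere_measure[OF Z])
  then show ?thesis by (rule integrable_const_bound[OF _ m])
qed

text \<open>
  Otherwise a hyperplane would strictly separate the mean from all values of \<open>F\<close> on the support.
\<close>

lemma barycentre_in_convex_hull:
  fixes F :: "'a::euclidean_space \<Rightarrow> 'b::euclidean_space"
  assumes Z: "sphere_measure Z" and F: "continuous_on (sphere 0 1) F"
    and pos: "measure Z (space Z) > 0"
  shows "(1 / measure Z (space Z)) *\<^sub>R (\<integral>u. F u \<partial>Z) \<in> convex hull (F ` supp Z)" (is "?z \<in> ?H")
proof (rule ccontr)
  assume z: "?z \<notin> ?H"
  interpret finite_measure Z using Z by (simp add: sphere_measure_def)
  have "continuous_on (supp Z) F" using F supp_subset_sphere[OF Z] by (rule continuous_on_subset)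
  then have "compact ?H" by (intro compact_convex_hull compact_continuous_image compact_supp Z)
  then obtain a b where ab: "a \<bullet> ?z < b" "\<And>x. x \<in> ?H \<Longrightarrow> a \<bullet> x > b"
    using separating_hyperplane_closed_point[OF convex_convex_hull compact_imp_closed z] by blast
  note int = integrable_sphere_measure[OF Z F]
  have "(\<integral>u. b \<partial>Z) \<le> (\<integral>u. a \<bullet> F u \<partial>Z)"
  proof (rule integral_mono_AE)
    show "AE u in Z. b \<le> a \<bullet> F u"
      using AE_in_supp[OF Z] by eventually_elim (auto intro!: less_imp_le ab(2) hull_inc)
  qed (use int in auto)
  also have "(\<integral>u. a \<bullet> F u \<partial>Z) = a \<bullet> (\<integral>u. F u \<partial>Z)" using int by simp
  finally show False using ab(1) pos by (simp add: divide_less_eq mult.commute)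
qed

text \<open>
  The matrix \<open>u u\<^sup>T\<close>, whose mean encodes isotropy.
\<close>

definition outer :: "real^'n \<Rightarrow> real^'n^'n" where
  "outer u = (\<chi> i j. u $ i * u $ j)"

lemma inner_outer: "outer x \<bullet> outer y = (x \<bullet> y)\<^sup>2"
  by (simp add: inner_vec_def outer_def power2_eq_square sum_product mult_ac)

lemma polarise_frame:
  fixes c :: "'a::euclidean_space \<Rightarrow> real"
  assumes "\<And>x. (\<Sum>u\<in>U. c u * (x \<bullet> u)\<^sup>2) = x \<bullet> x"
  shows "(\<Sum>u\<in>U. (c u * (y \<bullet> u)) *\<^sub>R u) = y"
proof -
  have "(\<Sum>u\<in>U. c u * (y \<bullet> u) * (x \<bullet> u)) = y \<bullet> x" for x
  proof -
    have "(\<Sum>u\<in>U. c u * ((x + y) \<bullet> u)\<^sup>2)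
      = (\<Sum>u\<in>U. c u * (x \<bullet> u)\<^sup>2) + (\<Sum>u\<in>U. c u * (y \<bullet> u)\<^sup>2) + 2 * (\<Sum>u\<in>U. c u * (y \<bullet> u) * (x \<bullet> u))"
      unfolding sum_distrib_left sum.distrib[symmetric]
      by (intro sum.cong refl) (simp add: inner_add_left power2_eq_square algebra_simps)
    then show ?thesis unfolding assms by (simp add: inner_add inner_commute)
  qed
  then have "x \<bullet> (\<Sum>u\<in>U. (c u * (y \<bullet> u)) *\<^sub>R u) = x \<bullet> y" for x
    by (simp add: inner_sum_right inner_commute[of y x])
  then have "\<forall>x. x \<bullet> (\<Sum>u\<in>U. (c u * (y \<bullet> u)) *\<^sub>R u) = x \<bullet> y" ..
  then show ?thesis by (rule vector_eq_ldot[THEN iffD1])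
qed

text \<open>
  The pair of the mean of \<open>u u\<^sup>T\<close> and the mean of \<open>u\<close> expresses isotropy and centring. It lies in the convex
  hull of the pairs \<open>(u u\<^sup>T, u)\<close> with \<open>u\<close> in the support, so it is a finite convex combination of them.
\<close>

lemma ex_centered_unit_frame:
  fixes Z :: "(real^'n) measure"
  assumes iso: "isotropic Z" and cen: "centroid Z = 0"
  obtains U c where "U \<subseteq> supp Z" "centered_unit_frame U c (real CARD('n))"
proof -
  have Z: "sphere_measure Z" and quad: "\<And>x. (norm x)\<^sup>2 = (\<integral>u. \<bar>x \<bullet> u\<bar>\<^sup>2 \<partial>Z)"
    using iso by (auto simp: isotropic_def)
  interpret finite_measure Z using Z by (simp add: sphere_measure_def)
  define m where "m = measure Z (space Z)"
  have "m \<noteq> 0"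
  proof
    assume "m = 0"
    then have "space Z \<in> null_sets Z" by (simp add: m_def emeasure_eq_measure null_sets_def)
    then have "AE u in Z. u \<notin> space Z" by (rule AE_not_in)
    with AE_space[of Z] have "AE u in Z. \<bar>axis undefined 1 \<bullet> u\<bar>\<^sup>2 = 0" by eventually_elim simp
    then have "(\<integral>u. \<bar>axis undefined 1 \<bullet> u\<bar>\<^sup>2 \<partial>Z) = 0" by (rule integral_eq_zero_AE)
    then show False using quad[of "axis undefined 1"] by simp
  qed
  then have m: "m > 0" by (simp add: m_def order_less_le)
  define F where "F u = (outer u, u)" for u :: "real^'n"
  have "continuous_on (sphere 0 1) F"
    unfolding F_def outer_def by (intro continuous_intros)
  note int = integrable_sphere_measure[OF Z this] and bary = barycentre_in_convex_hull[OF Z this m[unfolded m_def]]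
  then obtain S t where S: "finite S" "S \<subseteq> F ` supp Z" "\<And>x. x \<in> S \<Longrightarrow> 0 \<le> t x" "sum t S = 1"
    "(\<Sum>v\<in>S. t v *\<^sub>R v) = (1 / m) *\<^sub>R (\<integral>u. F u \<partial>Z)"
    unfolding convex_hull_explicit m_def by blast
  have injF: "inj_on F A" for A by (auto simp: inj_on_def F_def)
  obtain V where V: "V \<subseteq> supp Z" "S = F ` V" using S(2) by (auto simp: subset_image_iff)
  have finV: "finite V" using S(1) V(2) injF finite_image_iff by blast
  define c where "c u = m * t (F u)" for u
  define U where "U = {u\<in>V. c u > 0}"
  \<comment> \<open>Points of weight 0 are discarded, as a frame requires positive weights.\<close>
  have "(\<Sum>u\<in>U. c u *\<^sub>R F u) = (\<Sum>u\<in>V. c u *\<^sub>R F u)"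
  proof (rule sum.mono_neutral_left[OF finV])
    show "\<forall>u\<in>V - U. c u *\<^sub>R F u = 0"
    proof
      fix u assume u: "u \<in> V - U"
      then have "c u \<ge> 0" using S(3)[of "F u"] V(2) m by (simp add: c_def)
      then show "c u *\<^sub>R F u = 0" using u by (auto simp: U_def)
    qed
  qed (auto simp: U_def)
  also have "\<dots> = m *\<^sub>R (\<Sum>v\<in>S. t v *\<^sub>R v)"
    unfolding V(2) by (simp add: sum.reindex injF scaleR_sum_right c_def)
  also have "\<dots> = (\<integral>u. F u \<partial>Z)" using m by (simp add: S(5))
  finally have UF: "(\<Sum>u\<in>U. c u *\<^sub>R F u) = (\<integral>u. F u \<partial>Z)" .
  have inner_int: "(\<integral>u. a \<bullet> F u \<partial>Z) = (\<Sum>u\<in>U. c u * (a \<bullet> F u))" for a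
    using int UF[symmetric] by (simp add: inner_sum_right)
  have USphere: "U \<subseteq> sphere 0 1" using V(1) supp_subset_sphere[OF Z] by (auto simp: U_def)
  have "centered_unit_frame U c (real CARD('n))"
  proof
    show "finite U" using finV by (simp add: U_def)
    show "c u > 0" if "u \<in> U" for u using that by (simp add: U_def)
    show "norm u = 1" if "u \<in> U" for u using that USphere by auto
    show "(\<Sum>u\<in>U. (c u * (y \<bullet> u)) *\<^sub>R u) = y" for y
    proof (rule polarise_frame)
      fix x :: "real^'n"
      have "x \<bullet> x = (\<integral>u. (outer x, 0) \<bullet> F u \<partial>Z)"
        using quad[of x] by (simp add: F_def inner_outer power2_norm_eq_inner)
      also have "\<dots> = (\<Sum>u\<in>U. c u * (x \<bullet> u)\<^sup>2)" unfolding inner_int by (simp add: F_def inner_outer)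
      finally show "(\<Sum>u\<in>U. c u * (x \<bullet> u)\<^sup>2) = x \<bullet> x" by simp
    qed
    show "(\<Sum>u\<in>U. c u *\<^sub>R u) = 0"
    proof -
      have "(\<Sum>u\<in>U. c u *\<^sub>R u) = snd (\<Sum>u\<in>U. c u *\<^sub>R F u)" by (simp add: snd_sum F_def)
      also have "\<dots> = (\<integral>u. snd (F u) \<partial>Z)"
        unfolding UF by (rule integral_bounded_linear[OF bounded_linear_snd int, symmetric])
      also have "\<dots> = 0" using cen m by (simp add: centroid_def F_def m_def)
      finally show ?thesis .
    qed
  qed simp
  moreover have "U \<subseteq> supp Z" using V(1) by (auto simp: U_def)
  ultimately show ?thesis using that by blast
qed

section \<open>Regular simplices and the equality case\<close>

context centered_unit_frame
begin

text \<open>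
  Pair an affine relation with \<open>v\<close>: since all other inner products equal \<open>- 1 / n\<close>, the coefficient of \<open>v\<close>
  vanishes.
\<close>

lemma affine_independent_if_card:
  assumes "card U = CARD('n) + 1"
  shows "\<not> affine_dependent U"
proof
  assume "affine_dependent U"
  then obtain a v where a: "sum a U = 0" "v \<in> U" "a v \<noteq> 0" "(\<Sum>u\<in>U. a u *\<^sub>R u) = 0"
    using affine_dependent_explicit_finite[OF finite_I] by blast
  have vv: "v \<bullet> v = 1" using norm_w[OF a(2)] by (simp add: norm_eq_1)
  have "0 = (\<Sum>u\<in>U. a u * (u \<bullet> v))"
    using arg_cong[OF a(4), of "\<lambda>x. x \<bullet> v"] by (simp add: inner_sum_left)
  also have "\<dots> = a v + (\<Sum>u\<in>U-{v}. a u * (u \<bullet> v))"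
    using finite_I a(2) by (simp add: sum.remove[of U v] vv)
  also have "(\<Sum>u\<in>U-{v}. a u * (u \<bullet> v)) = - (\<Sum>u\<in>U-{v}. a u) / n"
    using inner_if_card[OF assms _ a(2)] by (simp add: sum_divide_distrib sum_negf)
  also have "(\<Sum>u\<in>U-{v}. a u) = - a v"
    using a(1) finite_I a(2) by (simp add: sum.remove[of U v])
  finally have "0 = a v * (1 + 1 / n)" by (simp add: algebra_simps)
  moreover have "1 + 1 / n > 0" by (intro add_pos_pos) auto
  ultimately show False using a(3) by simp
qed

lemma regular_simplex_if_card:
  assumes card: "card U = CARD('n) + 1"
  shows "regular_simplex (convex hull U)" "inscribed_in_sphere (convex hull U)"
proof -
  note indep = affine_independent_if_card[OF card]
  have vert: "vertices (convex hull U) = U"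
    using extreme_point_of_convex_hull_affine_independent[OF indep] by (auto simp: vertices_def)
  have "dist u v = sqrt (2 + 2 / n)" if "u \<in> U" "v \<in> U" "u \<noteq> v" for u v
  proof -
    have "(u - v) \<bullet> (u - v) = 2 - 2 * (u \<bullet> v)"
      using norm_w[OF that(1)] norm_w[OF that(2)] by (simp add: inner_diff inner_commute norm_eq_1)
    then show ?thesis using inner_if_card[OF card that] by (simp add: dist_norm norm_eq_sqrt_inner)
  qed
  then show "regular_simplex (convex hull U)"
    unfolding regular_simplex_def vert using card indep simplex_convex_hull[of U "int DIM(real^'n)"] by auto
  show "inscribed_in_sphere (convex hull U)"
    unfolding inscribed_in_sphere_def vert using norm_w by auto
qed

text \<open>
  A further unit vector \<open>v\<close> cuts off an open piece of the polar: \<open>v\<close> has inner product less than 1 with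
  every vector of \<open>U\<close>, so \<open>s v\<close> with \<open>s\<close> slightly above 1 still belongs to the open polar.
\<close>

lemma polar_loses_volume:
  assumes v: "norm v = 1" "v \<notin> U" and S: "S \<in> sets borel" "S \<subseteq> polar" "\<And>x. x \<in> S \<Longrightarrow> x \<bullet> v \<le> 1"
  shows "emeasure lborel S < emeasure lborel polar"
proof -
  define W where "W = open_polar \<inter> {x. x \<bullet> v > 1}"
  have vv: "v \<bullet> v = 1" using v by (simp add: norm_eq_1)
  have oW: "open W" unfolding W_def
    by (intro open_Int open_open_polar open_Collect_less continuous_intros)
  have "W \<noteq> {}"
  proof -
    have "eventually (\<lambda>s. \<forall>u\<in>U. s * (v \<bullet> u) < 1) (at_right 1)"
    proof (subst eventually_ball_finite_distrib[OF finite_I], intro ballI)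
      fix u assume u: "u \<in> U"
      then have "1 * (v \<bullet> u) < 1" using inner_unit_less_1[of v u] v norm_w[OF u] by auto
      moreover have "((\<lambda>s. s * (v \<bullet> u)) \<longlongrightarrow> 1 * (v \<bullet> u)) (at_right 1)" by (intro tendsto_intros)
      ultimately show "eventually (\<lambda>s. s * (v \<bullet> u) < 1) (at_right 1)" using order_tendstoD(2) by blast
    qed
    moreover have "eventually (\<lambda>s. s > (1::real)) (at_right 1)" by (rule eventually_at_right_less)
    ultimately have "eventually (\<lambda>s. s *\<^sub>R v \<in> W) (at_right 1)"
      by eventually_elim (simp add: W_def open_polar_def vv)
    then obtain s where "s *\<^sub>R v \<in> W" using eventually_happens[of _ "at_right (1::real)"] by auto
    then show ?thesis by auto
  qed
  then have "\<not> negligible W" using oW open_not_negligible by blast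
  then have W: "emeasure lborel W > 0"
    using oW by (auto simp: negligible_iff_null_sets null_sets_def zero_less_iff_neq_zero)
  have disj: "S \<inter> W = {}" using S(3) by (force simp: W_def)
  have "emeasure lborel S + emeasure lborel W = emeasure lborel (S \<union> W)"
    using S(1) oW disj by (intro plus_emeasure) auto
  also have "\<dots> \<le> emeasure lborel polar"
    using S(2) closed_polar by (intro emeasure_mono) (auto simp: W_def open_polar_def polar_def less_imp_le)
  finally have le: "emeasure lborel S + emeasure lborel W \<le> emeasure lborel polar" .
  have "emeasure lborel S \<le> emeasure lborel polar"
    using S closed_polar by (intro emeasure_mono) auto
  then have "emeasure lborel S < \<infinity>"
    using emeasure_polar_le by (metis ennreal_less_top infinity_ennreal_def order_le_less_trans)
  then have "emeasure lborel S + 0 < emeasure lborel S + emeasure lborel W"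
    using W by (intro ennreal_add_left_cancel_less[THEN iffD2]) auto
  from order_less_le_trans[OF this le] show ?thesis by simp
qed

end

text \<open>
  Points of the sphere are exposed: the half-space \<open>v \<bullet> x < 1\<close> contains all other unit vectors.
\<close>

lemma sphere_inter_inscribed_hull:
  fixes C :: "'a::euclidean_space set"
  assumes "C \<subseteq> sphere 0 1"
  shows "convex hull C \<inter> sphere 0 1 \<subseteq> C"
proof (rule subsetI, rule ccontr)
  fix v assume v: "v \<in> convex hull C \<inter> sphere 0 1" "v \<notin> C"
  have "convex hull C \<subseteq> {x. v \<bullet> x < 1}"
  proof (rule hull_minimal)
    show "C \<subseteq> {x. v \<bullet> x < 1}"
    proof
      fix x assume x: "x \<in> C"
      then have "norm x = 1" "v \<noteq> x" using assms v by auto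
      then show "x \<in> {x. v \<bullet> x < 1}" using v inner_unit_less_1[of v x] by simp
    qed
  qed (rule convex_halfspace_lt)
  then show False using v by (auto simp: norm_eq_1)
qed

theorem theorem1:
  fixes Z :: "(real ^ 'n) measure" and n :: nat
  assumes "n = CARD('n)"
    and "isotropic Z"
    and "centroid Z = 0"
  shows "emeasure lborel (Z_inf_polar Z)
           \<le> ennreal (real n powr (real n / 2) * real (n + 1) powr (real (n + 1) / 2) / fact n)
       \<and> (emeasure lborel (Z_inf_polar Z)
           = ennreal (real n powr (real n / 2) * real (n + 1) powr (real (n + 1) / 2) / fact n)
         \<longleftrightarrow> regular_simplex (Z_inf Z) \<and> inscribed_in_sphere (Z_inf Z))"
proof -
  let ?B = "ennreal (max_volume CARD('n))"
  obtain U c where US: "U \<subseteq> supp Z" and "centered_unit_frame U c (real CARD('n))"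
    using ex_centered_unit_frame[OF assms(2,3)] .
  then interpret centered_unit_frame U c "real CARD('n)" by simp
  have B: "ennreal (real n powr (real n / 2) * real (n + 1) powr (real (n + 1) / 2) / fact n) = ?B"
    using max_volume_powr[of "CARD('n)"] by (simp only: assms(1)) simp
  have sphere: "supp Z \<subseteq> sphere 0 1" using assms(2) supp_subset_sphere by (auto simp: isotropic_def)
  have sub: "Z_inf_polar Z \<subseteq> polar" using US by (auto simp: Z_inf_polar_def polar_def)
  have eq: "Z_inf_polar Z = polar" if "supp Z = U" using that by (auto simp: Z_inf_polar_def polar_def)
  have le: "emeasure lborel (Z_inf_polar Z) \<le> emeasure lborel polar"
    using sub closed_polar by (intro emeasure_mono) auto
  have "regular_simplex (Z_inf Z) \<and> inscribed_in_sphere (Z_inf Z)" if E: "emeasure lborel (Z_inf_polar Z) = ?B"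
  proof -
    have pB: "emeasure lborel polar = ?B" using E le emeasure_polar_le by simp
    then have card: "card U = CARD('n) + 1" by (simp add: emeasure_polar_eq_iff_card)
    have "supp Z \<subseteq> U"
    proof (rule subsetI, rule ccontr)
      fix v assume v: "v \<in> supp Z" "v \<notin> U"
      have "Z_inf_polar Z = (\<Inter>v\<in>supp Z. {x. x \<bullet> v \<le> 1})" by (auto simp: Z_inf_polar_def)
      then have "closed (Z_inf_polar Z)" by (auto intro!: closed_INT closed_Collect_le continuous_intros)
      then have "emeasure lborel (Z_inf_polar Z) < emeasure lborel polar"
        using v sphere sub by (intro polar_loses_volume[of v]) (auto simp: Z_inf_polar_def)
      then show False using E pB by simp
    qed
    then have "Z_inf Z = convex hull U" using US by (simp add: Z_inf_def antisym)
    then show ?thesis using regular_simplex_if_card[OF card] by simp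
  qed
  moreover have "emeasure lborel (Z_inf_polar Z) = ?B" if reg: "regular_simplex (Z_inf Z)" and ins: "inscribed_in_sphere (Z_inf Z)"
  proof -
    obtain C where C: "\<not> affine_dependent C" "card C = CARD('n) + 1" "Z_inf Z = convex hull C"
      using reg unfolding regular_simplex_def simplex_def by auto
    have "vertices (Z_inf Z) = C"
      using extreme_point_of_convex_hull_affine_independent[OF C(1)] by (auto simp: vertices_def C(3))
    then have "C \<subseteq> sphere 0 1" using ins by (simp add: inscribed_in_sphere_def)
    then have "supp Z \<subseteq> C"
      using sphere_inter_inscribed_hull[of C] sphere hull_subset[of "supp Z" convex] C(3) by (auto simp: Z_inf_def)
    moreover have "U = C"
      using US \<open>supp Z \<subseteq> C\<close> card_U_ge C(2) aff_independent_finite[OF C(1)] by (intro card_seteq) auto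
    ultimately have "supp Z = U" "card U = CARD('n) + 1" using US C(2) by auto
    then show ?thesis using eq emeasure_polar_eq_iff_card by simp
  qed
  ultimately show ?thesis unfolding B using le emeasure_polar_le by (auto intro: order_trans)
qed

end
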